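(* Let $\mathcal W$ be a discrete memoryless channel from a finite set $\mathcal X$ to a finite set $\mathcal Y$. Then for every integer $L\ge1$, $E_L^{\emptyset}(0^+,\mathcal W)\le U(\mathcal W)$, and moreover $\sup_{L\ge1}E_L^{\emptyset}(0^+,\mathcal W)=U(\mathcal W)$.
   Context: For probability distributions $P,Q$ on a finite set, $D(P\|Q)=\sum_x P(x)\log\frac{P(x)}{Q(x)}$ ($0\log(0/q)=0$; $+\infty$ if $P\not\ll Q$). A discrete memoryless channel $\mathcal W$ is a stochastic matrix $(\mathcal W(y|x))$; $\mathcal W^{\times n}(y^n|x^n)=\prod_i\mathcal W(y_i|x_i)$. The channel umlaut information is $U(\mathcal W)=\max_{P_X}\min_{Q_Y}D(P_X\times Q_Y\|P_{XY})$, $P_{XY}(x,y)=P_X(x)\mathcal W(y|x)$. An $L$-list unassisted code for message set $[M]$ (with $M\ge L$) and channel $\mathcal W$ consists of an encoder, i.e. a conditional distribution $\mathcal E(x|w)$, $w\in[M]$, and a decoder, i.e. a conditional distribution $\mathcal D(S|y)$ over subsets $S\subseteq[M]$ of cardinality $L$. With a uniformly distributed message $W$, the error probability is $\mathbb P[W\notin \hat S]$ where $\hat S$ is the decoder output; $\epsilon_L^{\emptyset}(M,\mathcal W)$ is the minimum error probability over such codes. Define $E_L^\emptyset(r,\mathcal W)=\liminf_{n\to\infty}-\frac1n\log\epsilon_L^\emptyset(\lceil L e^{rn}\rceil,\mathcal W^{\times n})$ and $E_L^\emptyset(0^+,\mathcal W)=\lim_{r\to0^+}E_L^\emptyset(r,\mathcal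 W)$.
   Formalization: The maximum over P_X in the definition of U(W) is taken as a supremum, since it need not be attained (e.g. for a Z-channel, where the objective drops to 0 at the boundary input distribution); the two agree whenever the maximum exists. *)

theory Defs
  imports "HOL-Analysis.Analysis" "HOL-Library.Extended_Real"
begin

definition is_distr :: "('a::finite \<Rightarrow> real) \<Rightarrow> bool" where
  "is_distr P \<longleftrightarrow> (\<forall>x. P x \<ge> 0) \<and> sum P UNIV = 1"

definition KL_div :: "('a::finite \<Rightarrow> real) \<Rightarrow> ('a \<Rightarrow> real) \<Rightarrow> ereal" where
  "KL_div P Q = (if \<exists>x. P x > 0 \<and> Q x = 0 then \<infinity>
     else ereal (\<Sum>x\<in>{x. P x > 0}. P x * ln (P x / Q x)))"

definition is_channel :: "('x::finite \<Rightarrow> 'y::finite \<Rightarrow> real) \<Rightarrow> bool" where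
  "is_channel W \<longleftrightarrow> (\<forall>x. is_distr (W x))"

definition umlaut_info :: "('x::finite \<Rightarrow> 'y::finite \<Rightarrow> real) \<Rightarrow> ereal" where
  "umlaut_info W = (SUP P\<in>{P. is_distr P}. INF Q\<in>{Q. is_distr Q}.
      KL_div (\<lambda>(x,y). P x * Q y) (\<lambda>(x,y). P x * W x y))"

(* n-fold memoryless extension, inputs/outputs are lists of length n *)
definition channel_power :: "('x \<Rightarrow> 'y \<Rightarrow> real) \<Rightarrow> 'x list \<Rightarrow> 'y list \<Rightarrow> real" where
  "channel_power W xs ys = prod_list (map2 W xs ys)"

(* L-list unassisted codes for message set {0..<M} over a channel V from finite
   input set A to finite output set B.  Enc w x = E(x|w), Dec y S = D(S|y). *)
definition list_subsets :: "nat \<Rightarrow> nat \<Rightarrow> nat set set" where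
  "list_subsets L M = {S. S \<subseteq> {..<M} \<and> card S = L}"

definition is_list_code ::
  "nat \<Rightarrow> nat \<Rightarrow> 'a set \<Rightarrow> 'b set \<Rightarrow> (nat \<Rightarrow> 'a \<Rightarrow> real) \<Rightarrow> ('b \<Rightarrow> nat set \<Rightarrow> real) \<Rightarrow> bool" where
  "is_list_code L M A B Enc Dec \<longleftrightarrow>
     (\<forall>w<M. (\<forall>x\<in>A. Enc w x \<ge> 0) \<and> (\<Sum>x\<in>A. Enc w x) = 1) \<and>
     (\<forall>y\<in>B. (\<forall>S\<in>list_subsets L M. Dec y S \<ge> 0) \<and> (\<Sum>S\<in>list_subsets L M. Dec y S) = 1)"

definition list_code_error ::
  "nat \<Rightarrow> nat \<Rightarrow> 'a set \<Rightarrow> 'b set \<Rightarrow> ('a \<Rightarrow> 'b \<Rightarrow> real) \<Rightarrow> (nat \<Rightarrow> 'a \<Rightarrow> real) \<Rightarrow> ('b \<Rightarrow> nat set \<Rightarrow> real) \<Rightarrow> real" where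
  "list_code_error L M A B V Enc Dec =
     (1 / real M) * (\<Sum>w<M. \<Sum>x\<in>A. \<Sum>y\<in>B. Enc w x * V x y *
        (\<Sum>S\<in>{S\<in>list_subsets L M. w \<notin> S}. Dec y S))"

definition min_list_error :: "nat \<Rightarrow> nat \<Rightarrow> 'a set \<Rightarrow> 'b set \<Rightarrow> ('a \<Rightarrow> 'b \<Rightarrow> real) \<Rightarrow> real" where
  "min_list_error L M A B V = Inf {list_code_error L M A B V Enc Dec | Enc Dec.
      is_list_code L M A B Enc Dec}"

definition eps_n :: "nat \<Rightarrow> nat \<Rightarrow> nat \<Rightarrow> ('x::finite \<Rightarrow> 'y::finite \<Rightarrow> real) \<Rightarrow> real" where
  "eps_n L M n W = min_list_error L M {xs. length xs = n} {ys. length ys = n} (channel_power W)"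

definition neg_log_rate :: "real \<Rightarrow> nat \<Rightarrow> ereal" where
  "neg_log_rate e n = (if e \<le> 0 then \<infinity> else ereal (- ln e / real n))"

definition list_exponent :: "nat \<Rightarrow> real \<Rightarrow> ('x::finite \<Rightarrow> 'y::finite \<Rightarrow> real) \<Rightarrow> ereal" where
  "list_exponent L r W = liminf (\<lambda>n. neg_log_rate
      (eps_n L (nat \<lceil>real L * exp (r * real n)\<rceil>) n W) n)"

definition list_exponent_zero_rate :: "nat \<Rightarrow> ('x::finite \<Rightarrow> 'y::finite \<Rightarrow> real) \<Rightarrow> ereal" where
  "list_exponent_zero_rate L W = Lim (at_right (0::real)) (\<lambda>r. list_exponent L r W)"

end

theory Submission
  imports Defs
begin

text \<open>Achievability: with i.i.d. random codewords and maximum likelihood list decoding, Gallager's bound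
  at its extreme parameter \<open>\<rho> = L\<close> gives error at most \<open>M\<^sup>L G\<^sub>L\<^sup>n\<close>, where
  \<open>G\<^sub>L = (\<Sum>y. (\<Sum>x. P x * W x y powr (1 / (L + 1))) ^ (L + 1))\<close>. As \<open>L\<close> grows, the power mean of order
  \<open>1 / (L + 1)\<close> tends to the weighted geometric mean of the \<open>W x y\<close>, and minus the logarithm of the
  sum over \<open>y\<close> of that mean is exactly the inner minimum over \<open>Q\<close> in the umlaut information.

  Converse: replace the channel by one whose output has distribution \<open>Q\<close> independently of the input.
  Every code then errs with probability \<open>1 - L / M\<close>, so data processing bounds the true error
  probability \<open>\<epsilon>\<close> by \<open>(1 - L / M) * ln (1 / \<epsilon>) \<le> D + ln 2\<close>, and a product \<open>Q\<close> adapted to the marginals of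
  the codebook makes the divergence \<open>D\<close> at most \<open>n\<close> times the umlaut information. At any positive rate
  \<open>L / M\<close> vanishes.\<close>

section \<open>Sums over words\<close>

lemma finite_words [simp]: "finite {xs::'a::finite list. length xs = n}"
  using finite_lists_length_eq[of "UNIV::'a set" n] by simp

lemma words_nonempty: "{xs::'a list. length xs = n} \<noteq> {}"
  by (auto intro: exI[of _ "replicate n undefined"])

text \<open>Distributivity. The factors may vary with the position because the converse uses a
  product output distribution with a different factor at each letter.\<close>

lemma sum_words_prod:
  fixes f :: "nat \<Rightarrow> 'a::finite \<Rightarrow> 'b::comm_semiring_1"
  shows "(\<Sum>xs\<in>{xs. length xs = n}. \<Prod>j<n. f j (xs ! j)) = (\<Prod>j<n. \<Sum>x\<in>UNIV. f j x)"
proof (induction n arbitrary: f)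
  case 0
  show ?case by simp
next
  case (Suc n)
  have words: "{xs::'a list. length xs = Suc n} = (\<lambda>(x, xs). x # xs) ` (UNIV \<times> {xs. length xs = n})"
    by (auto simp: length_Suc_conv image_iff)
  have inj: "inj_on (\<lambda>(x, xs). x # xs) (UNIV \<times> {xs::'a list. length xs = n})"
    by (auto simp: inj_on_def)
  have "(\<Sum>xs\<in>{xs. length xs = Suc n}. \<Prod>j<Suc n. f j (xs ! j))
      = (\<Sum>x\<in>UNIV. \<Sum>xs\<in>{xs. length xs = n}. f 0 x * (\<Prod>j<n. f (Suc j) (xs ! j)))"
    unfolding words sum.reindex[OF inj]
    by (simp add: sum.cartesian_product case_prod_unfold prod.lessThan_Suc_shift
        del: prod.lessThan_Suc)
  also have "\<dots> = (\<Sum>x\<in>UNIV. f 0 x) * (\<Prod>j<n. \<Sum>x\<in>UNIV. f (Suc j) x)"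
    by (simp add: sum_distrib_left[symmetric] sum_distrib_right[symmetric]
        Suc.IH[of "\<lambda>j. f (Suc j)"])
  also have "\<dots> = (\<Prod>j<Suc n. \<Sum>x\<in>UNIV. f j x)"
    by (simp add: prod.lessThan_Suc_shift del: prod.lessThan_Suc)
  finally show ?case .
qed

text \<open>Inserting \<open>h\<close> at position \<open>i\<close> leaves every other factor
  summing to 1. This splits the divergence in the converse into letterwise terms.\<close>

lemma sum_words_prod_nth:
  fixes Q :: "nat \<Rightarrow> 'a::finite \<Rightarrow> real"
  assumes "\<And>j. j < n \<Longrightarrow> (\<Sum>y\<in>UNIV. Q j y) = 1" and "i < n"
  shows "(\<Sum>ys\<in>{ys. length ys = n}. (\<Prod>j<n. Q j (ys ! j)) * h (ys ! i)) = (\<Sum>y\<in>UNIV. Q i y * h y)"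
proof -
  have "(\<Sum>ys\<in>{ys. length ys = n}. (\<Prod>j<n. Q j (ys ! j)) * h (ys ! i))
      = (\<Sum>ys\<in>{ys. length ys = n}. \<Prod>j<n. Q j (ys ! j) * (if j = i then h (ys ! j) else 1))"
    using \<open>i < n\<close> by (simp add: prod.distrib prod.delta)
  also have "\<dots> = (\<Prod>j<n. \<Sum>y\<in>UNIV. Q j y * (if j = i then h y else 1))"
    by (rule sum_words_prod)
  also have "\<dots> = (\<Prod>j<n. if j = i then \<Sum>y\<in>UNIV. Q j y * h y else 1)"
    using assms(1) by (intro prod.cong) auto
  also have "\<dots> = (\<Sum>y\<in>UNIV. Q i y * h y)"
    using \<open>i < n\<close> by (simp add: prod.delta)
  finally show ?thesis .
qed

lemma channel_power_eq_prod:
  assumes "length xs = n" "length ys = n"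
  shows "channel_power W xs ys = (\<Prod>j<n. W (xs ! j) (ys ! j))"
proof -
  have "length xs = length ys" using assms by simp
  then have "channel_power W xs ys = (\<Prod>j<length ys. W (xs ! j) (ys ! j))"
    by (induction xs ys rule: list_induct2)
      (simp_all add: channel_power_def prod.lessThan_Suc_shift del: prod.lessThan_Suc)
  then show ?thesis using assms by simp
qed

lemma is_channel_nonneg: "is_channel W \<Longrightarrow> W x y \<ge> 0"
  by (simp add: is_channel_def is_distr_def)

lemma is_channel_sum: "is_channel W \<Longrightarrow> (\<Sum>y\<in>UNIV. W x y) = 1"
  by (simp add: is_channel_def is_distr_def)

lemma is_distr_le_1:
  assumes "is_distr P" shows "P x \<le> 1"
  using assms member_le_sum[of x UNIV P] by (auto simp: is_distr_def)

lemma channel_power_nonneg: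
  assumes "is_channel W" "length xs = n" "length ys = n"
  shows "channel_power W xs ys \<ge> 0"
  by (simp add: channel_power_eq_prod[OF assms(2,3)] prod_nonneg is_channel_nonneg[OF assms(1)])

lemma channel_power_sum:
  assumes "is_channel W" "length xs = n"
  shows "(\<Sum>ys\<in>{ys. length ys = n}. channel_power W xs ys) = 1"
proof -
  have "(\<Sum>ys\<in>{ys. length ys = n}. channel_power W xs ys)
      = (\<Sum>ys\<in>{ys. length ys = n}. \<Prod>j<n. W (xs ! j) (ys ! j))"
    using assms(2) by (intro sum.cong) (auto simp: channel_power_eq_prod)
  also have "\<dots> = (\<Prod>j<n. \<Sum>y\<in>UNIV. W (xs ! j) y)" by (rule sum_words_prod)
  finally show ?thesis by (simp add: is_channel_sum[OF assms(1)])
qed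

section \<open>List codes\<close>

lemma finite_list_subsets [simp]: "finite (list_subsets L M)"
  by (rule finite_subset[of _ "Pow {..<M}"]) (auto simp: list_subsets_def)

lemma list_code_error_nonneg:
  assumes code: "is_list_code L M A B Enc Dec"
    and V: "\<And>x y. x \<in> A \<Longrightarrow> y \<in> B \<Longrightarrow> V x y \<ge> 0"
  shows "list_code_error L M A B V Enc Dec \<ge> 0"
proof -
  have "(\<Sum>S\<in>{S \<in> list_subsets L M. w \<notin> S}. Dec y S) \<ge> 0" if "y \<in> B" for w y
    using code that by (intro sum_nonneg) (auto simp: is_list_code_def)
  then show ?thesis
    using code V unfolding list_code_error_def
    by (intro mult_nonneg_nonneg sum_nonneg) (auto simp: is_list_code_def)
qed

lemma min_list_error_le:
  assumes code: "is_list_code L M A B Enc Dec"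
    and V: "\<And>x y. x \<in> A \<Longrightarrow> y \<in> B \<Longrightarrow> V x y \<ge> 0"
  shows "min_list_error L M A B V \<le> list_code_error L M A B V Enc Dec"
  unfolding min_list_error_def
proof (rule cInf_lower)
  show "bdd_below {list_code_error L M A B V Enc Dec |Enc Dec. is_list_code L M A B Enc Dec}"
    using list_code_error_nonneg[of L M A B _ _ V, OF _ V] by (intro bdd_belowI[of _ 0]) auto
qed (use code in blast)

text \<open>Point masses embed a codebook \<open>c\<close> and a choice of lists \<open>S\<close>
  into the randomised codes; random coding draws only on codes of this kind.\<close>

lemma deterministic_list_code:
  assumes "finite A" "finite B"
    and c: "\<And>w. w < M \<Longrightarrow> c w \<in> A" and S: "\<And>y. y \<in> B \<Longrightarrow> S y \<in> list_subsets L M"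
  defines "Enc \<equiv> \<lambda>w x. if x = c w then 1 else 0"
    and "Dec \<equiv> \<lambda>y T. if T = S y then 1 else 0"
  shows "is_list_code L M A B Enc Dec"
    and "list_code_error L M A B V Enc Dec
      = 1 / real M * (\<Sum>w<M. \<Sum>y\<in>B. if w \<in> S y then 0 else V (c w) y)"
proof -
  show "is_list_code L M A B Enc Dec"
    using assms(1,2) c S by (auto simp: is_list_code_def Enc_def Dec_def sum.delta)
  have "(\<Sum>T\<in>{T \<in> list_subsets L M. w \<notin> T}. Dec y T) = (if w \<in> S y then 0 else 1)"
    if "y \<in> B" for w y
    using S[OF that] by (auto simp: Dec_def sum.delta)
  then have "(\<Sum>x\<in>A. \<Sum>y\<in>B. Enc w x * V x y * (\<Sum>T\<in>{T \<in> list_subsets L M. w \<notin> T}. Dec y T))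
      = (\<Sum>x\<in>A. if x = c w then (\<Sum>y\<in>B. if w \<in> S y then 0 else V (c w) y) else 0)" for w
    by (intro sum.cong) (auto simp: Enc_def intro!: sum.cong)
  then show "list_code_error L M A B V Enc Dec
      = 1 / real M * (\<Sum>w<M. \<Sum>y\<in>B. if w \<in> S y then 0 else V (c w) y)"
    using assms(1) c by (simp add: list_code_error_def sum.delta)
qed

lemma ex_is_list_code:
  assumes "finite A" "finite B" "A \<noteq> {}" "L \<le> M"
  shows "\<exists>Enc Dec. is_list_code L M A B Enc Dec"
proof -
  obtain a where "a \<in> A" using assms by auto
  moreover have "{..<L} \<in> list_subsets L M" using \<open>L \<le> M\<close> by (auto simp: list_subsets_def)
  ultimately show ?thesis
    using deterministic_list_code(1)[of A B M "\<lambda>_. a" "\<lambda>_. {..<L}" L] assms by blast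
qed

section \<open>Monotonicity in the number of messages\<close>

lemma list_subset_extend:
  assumes "T \<subseteq> {..<M}" "card T \<le> L" "L \<le> M"
  shows "\<exists>S\<in>list_subsets L M. T \<subseteq> S"
  using exists_subset_between[of T L "{..<M}"] assms by (auto simp: list_subsets_def)

text \<open>A code for \<open>M\<close> messages serves \<open>N\<close> of them: encode
  \<open>w\<close> as \<open>\<sigma> w\<close> and pull each decoded list back along
  \<open>\<sigma>\<close>. The pulled back list may be short; padding it to \<open>L\<close> members
  can only lower the error, whence the inequality.\<close>

lemma list_code_relabel:
  assumes "finite A" "finite B" and code: "is_list_code L M A B Enc Dec"
    and V: "\<And>x y. x \<in> A \<Longrightarrow> y \<in> B \<Longrightarrow> V x y \<ge> 0"
    and \<sigma>: "inj_on \<sigma> {..<N}" "\<sigma> ` {..<N} \<subseteq> {..<M}" and "L \<le> N"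
  shows "\<exists>Enc' Dec'. is_list_code L N A B Enc' Dec' \<and>
    list_code_error L N A B V Enc' Dec' \<le> 1 / real N * (\<Sum>w<N. \<Sum>x\<in>A. \<Sum>y\<in>B.
      Enc (\<sigma> w) x * V x y * (\<Sum>S\<in>{S \<in> list_subsets L M. \<sigma> w \<notin> S}. Dec y S))"
proof -
  have "\<exists>T\<in>list_subsets L N. {w. w < N \<and> \<sigma> w \<in> S} \<subseteq> T" if S: "S \<in> list_subsets L M" for S
  proof (rule list_subset_extend)
    have "card {w. w < N \<and> \<sigma> w \<in> S} = card (\<sigma> ` {w. w < N \<and> \<sigma> w \<in> S})"
      using \<sigma>(1) by (intro card_image[symmetric]) (auto simp: inj_on_def)
    also have "\<dots> \<le> card S"
      using S by (intro card_mono) (auto simp: list_subsets_def intro: finite_subset)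
    finally show "card {w. w < N \<and> \<sigma> w \<in> S} \<le> L" using S by (simp add: list_subsets_def)
  qed (use \<open>L \<le> N\<close> in auto)
  then obtain \<phi> where \<phi>: "\<And>S. S \<in> list_subsets L M \<Longrightarrow> \<phi> S \<in> list_subsets L N"
      and \<sigma>\<phi>: "\<And>S w. S \<in> list_subsets L M \<Longrightarrow> w < N \<Longrightarrow> \<sigma> w \<in> S \<Longrightarrow> w \<in> \<phi> S"
    by (metis (mono_tags, lifting) mem_Collect_eq subsetD)
  \<comment> \<open>The law of the padded list \<open>\<phi> S\<close> when \<open>S\<close> is
    drawn from \<open>Dec y\<close>.\<close>
  define Dec' where "Dec' y T = (\<Sum>S\<in>{S \<in> list_subsets L M. \<phi> S = T}. Dec y S)" for y T
  have Dec_nonneg: "Dec y S \<ge> 0" if "y \<in> B" "S \<in> list_subsets L M" for y S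
    using code that by (auto simp: is_list_code_def)
  have group: "(\<Sum>T\<in>{T \<in> list_subsets L N. Q T}. Dec' y T)
      = (\<Sum>S\<in>{S \<in> list_subsets L M. Q (\<phi> S)}. Dec y S)" for y Q
  proof -
    have "(\<Sum>S\<in>{S \<in> list_subsets L M. Q (\<phi> S)}. Dec y S)
        = (\<Sum>T\<in>{T \<in> list_subsets L N. Q T}.
            \<Sum>S\<in>{S \<in> {S \<in> list_subsets L M. Q (\<phi> S)}. \<phi> S = T}. Dec y S)"
      using \<phi> by (intro sum.group[symmetric]) auto
    also have "\<dots> = (\<Sum>T\<in>{T \<in> list_subsets L N. Q T}. Dec' y T)"
      unfolding Dec'_def by (intro sum.cong) auto
    finally show ?thesis by simp
  qed
  have code': "is_list_code L N A B (\<lambda>w. Enc (\<sigma> w)) Dec'"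
    unfolding is_list_code_def
  proof (intro conjI allI impI ballI)
    fix y assume "y \<in> B"
    then show "Dec' y S \<ge> 0" for S
      unfolding Dec'_def using Dec_nonneg by (intro sum_nonneg) auto
    show "sum (Dec' y) (list_subsets L N) = 1"
      using group[where Q = "\<lambda>_. True"] code \<open>y \<in> B\<close> by (auto simp: is_list_code_def)
  qed (use code \<sigma>(2) in \<open>auto simp: is_list_code_def\<close>)
  have "(\<Sum>T\<in>{T \<in> list_subsets L N. w \<notin> T}. Dec' y T)
      \<le> (\<Sum>S\<in>{S \<in> list_subsets L M. \<sigma> w \<notin> S}. Dec y S)" if "w < N" "y \<in> B" for w y
    unfolding group using that \<sigma>\<phi> Dec_nonneg by (intro sum_mono2) auto
  moreover have "Enc (\<sigma> w) x \<ge> 0" if "w < N" "x \<in> A" for w x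
    using code' that by (auto simp: is_list_code_def)
  ultimately have "list_code_error L N A B V (\<lambda>w. Enc (\<sigma> w)) Dec' \<le> 1 / real N *
      (\<Sum>w<N. \<Sum>x\<in>A. \<Sum>y\<in>B.
        Enc (\<sigma> w) x * V x y * (\<Sum>S\<in>{S \<in> list_subsets L M. \<sigma> w \<notin> S}. Dec y S))"
    unfolding list_code_error_def using V
    by (intro mult_left_mono sum_mono) auto
  with code' show ?thesis by blast
qed

text \<open>Dropping a message with the largest conditional error cannot raise the average error of
  the others.\<close>

lemma min_list_error_Suc:
  assumes "finite A" "finite B" "A \<noteq> {}" "L \<le> N" "N \<ge> 1"
    and V: "\<And>x y. x \<in> A \<Longrightarrow> y \<in> B \<Longrightarrow> V x y \<ge> 0"
  shows "min_list_error L N A B V \<le> min_list_error L (Suc N) A B V"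
proof -
  have "\<exists>e'\<in>{list_code_error L N A B V Enc Dec |Enc Dec. is_list_code L N A B Enc Dec}. e' \<le> e"
    if e_in: "e \<in> {list_code_error L (Suc N) A B V Enc Dec |Enc Dec. is_list_code L (Suc N) A B Enc Dec}"
      for e
  proof -
    obtain Enc Dec where code: "is_list_code L (Suc N) A B Enc Dec"
        and e: "e = list_code_error L (Suc N) A B V Enc Dec"
      using e_in by blast
    define err where "err w = (\<Sum>x\<in>A. \<Sum>y\<in>B.
      Enc w x * V x y * (\<Sum>S\<in>{S \<in> list_subsets L (Suc N). w \<notin> S}. Dec y S))" for w
    have e_err: "e = 1 / real (Suc N) * (\<Sum>w<Suc N. err w)"
      by (simp add: e list_code_error_def err_def)
    obtain v where v: "v < Suc N" "\<And>w. w < Suc N \<Longrightarrow> err w \<le> err v"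
    proof -
      have "Max (err ` {..<Suc N}) \<in> err ` {..<Suc N}" by (intro Max_in) auto
      then obtain v where "v < Suc N" "err v = Max (err ` {..<Suc N})" by auto
      moreover have "err w \<le> Max (err ` {..<Suc N})" if "w < Suc N" for w
        using that by (intro Max_ge) auto
      ultimately show ?thesis using that by metis
    qed
    \<comment> \<open>Renumbers the messages other than \<open>v\<close>: the slot freed by
      \<open>v\<close> goes to the last message \<open>N\<close>. For \<open>v = N\<close> this is
      the identity on \<open>{..<N}\<close>.\<close>
    define \<sigma> where "\<sigma> w = (if w = v then N else w)" for w
    have inj: "inj_on \<sigma> {..<N}" by (auto simp: inj_on_def \<sigma>_def)
    have im: "\<sigma> ` {..<N} = {..<Suc N} - {v}"
      using v(1) by (auto simp: \<sigma>_def image_iff less_Suc_eq)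
    have "(\<Sum>w<N. err (\<sigma> w)) = (\<Sum>w\<in>{..<Suc N} - {v}. err w)"
      unfolding im[symmetric] sum.reindex[OF inj] by simp
    also have "\<dots> = (\<Sum>w<Suc N. err w) - err v"
      using v(1) by (subst sum_diff1) auto
    finally have drop: "(\<Sum>w<N. err (\<sigma> w)) = (\<Sum>w<Suc N. err w) - err v" .
    have "(\<Sum>w<Suc N. err w) \<le> real (Suc N) * err v"
      using sum_bounded_above[of "{..<Suc N}" err "err v"] v(2) by simp
    then have "1 / real N * (\<Sum>w<N. err (\<sigma> w)) \<le> e"
      unfolding drop e_err using \<open>N \<ge> 1\<close> by (simp add: field_simps)
    moreover obtain Enc' Dec' where "is_list_code L N A B Enc' Dec'"
        "list_code_error L N A B V Enc' Dec' \<le> 1 / real N * (\<Sum>w<N. err (\<sigma> w))"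
    proof -
      have "\<sigma> ` {..<N} \<subseteq> {..<Suc N}" using im by auto
      from list_code_relabel[where V = V, OF assms(1,2) code _ inj this assms(4)] V show ?thesis
        using that unfolding err_def by auto
    qed
    ultimately have "list_code_error L N A B V Enc' Dec' \<le> e" "is_list_code L N A B Enc' Dec'"
      by auto
    then show ?thesis by blast
  qed
  moreover have "{list_code_error L (Suc N) A B V Enc Dec |Enc Dec.
      is_list_code L (Suc N) A B Enc Dec} \<noteq> {}"
    using ex_is_list_code[of A B L "Suc N"] assms by auto
  moreover have "bdd_below {list_code_error L N A B V Enc Dec |Enc Dec. is_list_code L N A B Enc Dec}"
    using list_code_error_nonneg[of L N A B _ _ V, OF _ V] by (intro bdd_belowI[of _ 0]) auto
  ultimately show ?thesis
    unfolding min_list_error_def by (intro cInf_mono)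
qed

lemma min_list_error_mono:
  assumes "finite A" "finite B" "A \<noteq> {}" "L \<le> N" "N \<ge> 1" "N \<le> M"
    and V: "\<And>x y. x \<in> A \<Longrightarrow> y \<in> B \<Longrightarrow> V x y \<ge> 0"
  shows "min_list_error L N A B V \<le> min_list_error L M A B V"
  using \<open>N \<le> M\<close>
proof (induction M rule: dec_induct)
  case (step M)
  then show ?case using min_list_error_Suc[of A B L M V] assms by simp
qed simp

section \<open>Random coding\<close>

text \<open>A subset of maximal total weight works, since swapping a member for a heavier outsider
  would increase the sum. With \<open>v\<close> the likelihoods of the messages, \<open>S\<close> is
  the maximum likelihood list.\<close>

lemma ex_largest_subset:
  fixes v :: "nat \<Rightarrow> real"
  assumes "L \<le> M"
  shows "\<exists>S\<in>list_subsets L M. \<forall>i\<in>S. \<forall>w\<in>{..<M} - S. v w \<le> v i"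
proof -
  have "list_subsets L M \<noteq> {}"
    using list_subset_extend[of "{}" M L] assms by auto
  then have "Max (sum v ` list_subsets L M) \<in> sum v ` list_subsets L M"
    by (intro Max_in) auto
  then obtain S where S: "S \<in> list_subsets L M" "sum v S = Max (sum v ` list_subsets L M)"
    by auto
  have max: "sum v T \<le> sum v S" if "T \<in> list_subsets L M" for T
    unfolding S(2) using that by (intro Max_ge) auto
  have "v w \<le> v i" if "i \<in> S" "w < M" "w \<notin> S" for i w
  proof -
    have fin: "finite S" using S by (auto simp: list_subsets_def intro: finite_subset)
    have "card (insert w (S - {i})) = card S"
      using that fin card_Suc_Diff1[OF fin \<open>i \<in> S\<close>] by simp
    then have "insert w (S - {i}) \<in> list_subsets L M"
      using S that by (auto simp: list_subsets_def)
    then have "sum v (insert w (S - {i})) \<le> sum v S" by (rule max)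
    moreover have "sum v (insert w (S - {i})) = v w + sum v (S - {i})"
      using fin that by simp
    moreover have "sum v S = v i + sum v (S - {i})"
      using fin that by (simp add: sum.remove)
    ultimately show ?thesis by simp
  qed
  with S show ?thesis by auto
qed

lemma powr_inverse_power:
  assumes "v \<ge> 0"
  shows "(v powr (1 / real (Suc k))) ^ Suc k = v"
proof (cases "v = 0")
  case False
  then show ?thesis
    using assms by (simp add: powr_realpow[symmetric] powr_powr del: power_Suc)
qed simp

text \<open>\<open>S\<close> is the output of the maximum likelihood list decoder: if it misses \<open>w\<close>, then
  \<open>v w = (v w powr (1 / (L + 1))) ^ (L + 1)\<close> is at most the summand with \<open>T = S\<close>.\<close>

lemma likelihood_outside_list_le:
  fixes v :: "nat \<Rightarrow> real"
  assumes v: "\<And>i. i < M \<Longrightarrow> v i \<ge> 0" and S: "S \<in> list_subsets L M"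
    and max: "\<forall>i\<in>S. \<forall>w\<in>{..<M} - S. v w \<le> v i" and w: "w < M"
  shows "(if w \<in> S then 0 else v w)
    \<le> (\<Sum>T\<in>{T. T \<subseteq> {..<M} - {w} \<and> card T = L}. \<Prod>i\<in>insert w T. v i powr (1 / real (L + 1)))"
proof (cases "w \<in> S")
  case True
  then show ?thesis by (auto intro!: sum_nonneg prod_nonneg)
next
  case False
  let ?\<T> = "{T. T \<subseteq> {..<M} - {w} \<and> card T = L}"
  have fin: "finite S" using S by (auto simp: list_subsets_def intro: finite_subset)
  have "finite ?\<T>" by (rule finite_subset[of _ "Pow {..<M}"]) auto
  have "S \<in> ?\<T>" using S False by (auto simp: list_subsets_def)
  have "v w = (v w powr (1 / real (L + 1))) ^ (L + 1)"
    using powr_inverse_power[OF v[OF w], of L] by simp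
  also have "\<dots> = (\<Prod>i\<in>insert w S. v w powr (1 / real (L + 1)))"
    using False fin S by (simp add: list_subsets_def)
  also have "\<dots> \<le> (\<Prod>i\<in>insert w S. v i powr (1 / real (L + 1)))"
    using max w False v[OF w] by (intro prod_mono) (auto intro!: powr_mono2)
  also have "\<dots> \<le> (\<Sum>T\<in>?\<T>. \<Prod>i\<in>insert w T. v i powr (1 / real (L + 1)))"
    using \<open>S \<in> ?\<T>\<close> \<open>finite ?\<T>\<close>
    by (intro member_le_sum[where f = "\<lambda>T. \<Prod>i\<in>insert w T. v i powr (1 / real (L + 1))"])
      (auto intro: prod_nonneg)
  finally show ?thesis using False by simp
qed

text \<open>Independence of the codewords of a random codebook: the mean of a product over distinct
  indices factors, and codewords outside \<open>R\<close> contribute 1.\<close>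

lemma sum_codebooks_prod:
  fixes P f :: "'a \<Rightarrow> real" and R :: "nat set"
  assumes "finite A" "(\<Sum>x\<in>A. P x) = 1" "R \<subseteq> {..<M}"
  shows "(\<Sum>c\<in>{..<M} \<rightarrow>\<^sub>E A. (\<Prod>i<M. P (c i)) * (\<Prod>i\<in>R. f (c i)))
    = (\<Sum>x\<in>A. P x * f x) ^ card R"
proof -
  have "(\<Prod>i\<in>R. g i) = (\<Prod>i<M. if i \<in> R then g i else 1)" for g :: "nat \<Rightarrow> real"
    using assms(3) by (simp add: prod.If_cases Int_absorb1)
  then have "(\<Sum>c\<in>{..<M} \<rightarrow>\<^sub>E A. (\<Prod>i<M. P (c i)) * (\<Prod>i\<in>R. f (c i)))
      = (\<Sum>c\<in>{..<M} \<rightarrow>\<^sub>E A. \<Prod>i<M. P (c i) * (if i \<in> R then f (c i) else 1))"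
    by (simp add: prod.distrib)
  also have "\<dots> = (\<Prod>i<M. \<Sum>x\<in>A. P x * (if i \<in> R then f x else 1))"
    using assms(1) by (intro prod_sum_PiE[symmetric]) auto
  also have "\<dots> = (\<Prod>i<M. if i \<in> R then \<Sum>x\<in>A. P x * f x else 1)"
    using assms(2) by (intro prod.cong) auto
  also have "\<dots> = (\<Sum>x\<in>A. P x * f x) ^ card R"
    using assms(3) by (simp add: prod.If_cases Int_absorb1)
  finally show ?thesis .
qed

text \<open>Maximum likelihood list decoding for a fixed codebook. Summing over all competing lists
  \<open>T\<close> removes the decoder from the bound, so that it can be averaged over
  codebooks.\<close>

lemma min_list_error_codebook:
  assumes "finite A" "finite B" "L \<le> M" "c \<in> {..<M} \<rightarrow>\<^sub>E A"
    and V: "\<And>x y. x \<in> A \<Longrightarrow> y \<in> B \<Longrightarrow> V x y \<ge> 0"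
  shows "min_list_error L M A B V \<le> 1 / real M * (\<Sum>w<M. \<Sum>y\<in>B.
    \<Sum>T\<in>{T. T \<subseteq> {..<M} - {w} \<and> card T = L}. \<Prod>i\<in>insert w T. V (c i) y powr (1 / real (L + 1)))"
proof -
  have c: "c w \<in> A" if "w < M" for w using assms(4) that by auto
  define S where "S y = (SOME S. S \<in> list_subsets L M
    \<and> (\<forall>i\<in>S. \<forall>w\<in>{..<M} - S. V (c w) y \<le> V (c i) y))" for y
  have "S y \<in> list_subsets L M \<and> (\<forall>i\<in>S y. \<forall>w\<in>{..<M} - S y. V (c w) y \<le> V (c i) y)" for y
    unfolding S_def
    by (rule someI_ex) (use ex_largest_subset[OF assms(3), of "\<lambda>w. V (c w) y"] in blast)
  then have S: "\<And>y. S y \<in> list_subsets L M"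
    and max: "\<And>y. \<forall>i\<in>S y. \<forall>w\<in>{..<M} - S y. V (c w) y \<le> V (c i) y" by blast+
  note code = deterministic_list_code[where c = c and S = S and B = B, OF assms(1,2) c S]
  have "min_list_error L M A B V
      \<le> 1 / real M * (\<Sum>w<M. \<Sum>y\<in>B. if w \<in> S y then 0 else V (c w) y)"
    using min_list_error_le[OF code(1), of V] V code(2) by simp
  also have "\<dots> \<le> 1 / real M * (\<Sum>w<M. \<Sum>y\<in>B. \<Sum>T\<in>{T. T \<subseteq> {..<M} - {w} \<and> card T = L}.
      \<Prod>i\<in>insert w T. V (c i) y powr (1 / real (L + 1)))"
  proof (intro mult_left_mono sum_mono)
    fix w y assume "w \<in> {..<M}" "y \<in> B"
    then show "(if w \<in> S y then 0 else V (c w) y) \<le> (\<Sum>T\<in>{T. T \<subseteq> {..<M} - {w} \<and> card T = L}.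
        \<Prod>i\<in>insert w T. V (c i) y powr (1 / real (L + 1)))"
      using V c by (intro likelihood_outside_list_le[OF _ S max]) auto
  qed simp
  finally show ?thesis .
qed

text \<open>Average over codebooks with independent codewords of law \<open>P\<close>. Each product
  involves \<open>L + 1\<close> distinct codewords, so its mean is an \<open>(L + 1)\<close>-th
  power, and each message has at most \<open>M ^ L\<close> competing lists.\<close>

lemma random_coding_bound:
  assumes "finite A" "finite B" "1 \<le> L" "L \<le> M"
    and V: "\<And>x y. x \<in> A \<Longrightarrow> y \<in> B \<Longrightarrow> V x y \<ge> 0"
    and P: "\<And>x. x \<in> A \<Longrightarrow> P x \<ge> 0" "(\<Sum>x\<in>A. P x) = 1"
  shows "min_list_error L M A B V
    \<le> real M ^ L * (\<Sum>y\<in>B. (\<Sum>x\<in>A. P x * V x y powr (1 / real (L + 1))) ^ (L + 1))"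
proof -
  let ?C = "{..<M} \<rightarrow>\<^sub>E A" and ?\<T> = "\<lambda>w. {T. T \<subseteq> {..<M} - {w} \<and> card T = L}"
  let ?p = "\<lambda>c. \<Prod>i<M. P (c i)" and ?m = "\<lambda>y. \<Sum>x\<in>A. P x * V x y powr (1 / real (L + 1))"
  have p_sum: "(\<Sum>c\<in>?C. ?p c) = 1"
    using sum_codebooks_prod[OF assms(1) P(2), of "{}" M] by simp
  have p_nonneg: "?p c \<ge> 0" if "c \<in> ?C" for c
    using that P(1) by (intro prod_nonneg) auto
  have card_\<T>: "real (card (?\<T> w)) \<le> real M ^ L" if "w < M" for w
  proof -
    have "card (?\<T> w) = (M - 1) choose L"
      using n_subsets[of "{..<M} - {w}" L] that by simp
    also have "\<dots> \<le> (M - 1) ^ L" by (rule order_trans[OF _ binomial_fact_pow]) simp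
    also have "\<dots> \<le> M ^ L" by (intro power_mono) auto
    finally show ?thesis by (simp flip: of_nat_power)
  qed
  have mean: "(\<Sum>c\<in>?C. ?p c * (\<Prod>i\<in>insert w T. V (c i) y powr (1 / real (L + 1)))) = ?m y ^ (L + 1)"
    if "w < M" "T \<in> ?\<T> w" for w T y
  proof -
    have "finite T" using that(2) by (auto intro: finite_subset)
    moreover have "w \<notin> T" using that(2) by auto
    ultimately have "card (insert w T) = L + 1" using that(2) by simp
    moreover have "insert w T \<subseteq> {..<M}" using that by auto
    ultimately show ?thesis
      using sum_codebooks_prod[OF assms(1) P(2), of "insert w T" M "\<lambda>x. V x y powr (1 / real (L + 1))"]
      by simp
  qed
  \<comment> \<open>The minimal error does not depend on the codebook, so it equals its own
    \<open>?p\<close>-average and can be bounded codebook by codebook.\<close>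
  have "min_list_error L M A B V = (\<Sum>c\<in>?C. ?p c * min_list_error L M A B V)"
    using p_sum by (simp flip: sum_distrib_right)
  also have "\<dots> \<le> (\<Sum>c\<in>?C. ?p c * (1 / real M * (\<Sum>w<M. \<Sum>y\<in>B. \<Sum>T\<in>?\<T> w.
      \<Prod>i\<in>insert w T. V (c i) y powr (1 / real (L + 1)))))"
    using p_nonneg V assms(1,2,4) by (intro sum_mono mult_left_mono min_list_error_codebook) auto
  also have "\<dots> = 1 / real M * (\<Sum>c\<in>?C. \<Sum>w<M. \<Sum>y\<in>B. \<Sum>T\<in>?\<T> w.
      ?p c * (\<Prod>i\<in>insert w T. V (c i) y powr (1 / real (L + 1))))"
    by (simp add: sum_distrib_left mult_ac)
  also have "(\<Sum>c\<in>?C. \<Sum>w<M. \<Sum>y\<in>B. \<Sum>T\<in>?\<T> w.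
        ?p c * (\<Prod>i\<in>insert w T. V (c i) y powr (1 / real (L + 1))))
      = (\<Sum>w<M. \<Sum>y\<in>B. \<Sum>T\<in>?\<T> w. \<Sum>c\<in>?C.
          ?p c * (\<Prod>i\<in>insert w T. V (c i) y powr (1 / real (L + 1))))"
    by (subst sum.swap, rule sum.cong[OF refl], subst sum.swap, rule sum.cong[OF refl],
        subst sum.swap, rule refl)
  also have "\<dots> = (\<Sum>w<M. \<Sum>y\<in>B. \<Sum>T\<in>?\<T> w. ?m y ^ (L + 1))"
    using mean by (intro sum.cong refl) auto
  also have "\<dots> = (\<Sum>w<M. real (card (?\<T> w)) * (\<Sum>y\<in>B. ?m y ^ (L + 1)))"
    by (simp add: sum_distrib_left)
  finally have "min_list_error L M A B V
      \<le> 1 / real M * (\<Sum>w<M. real (card (?\<T> w)) * (\<Sum>y\<in>B. ?m y ^ (L + 1)))" .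
  also have "\<dots> \<le> 1 / real M * (\<Sum>w<M. real M ^ L * (\<Sum>y\<in>B. ?m y ^ (L + 1)))"
    using card_\<T> P(1)
    by (intro mult_left_mono sum_mono mult_right_mono sum_nonneg zero_le_power) auto
  also have "\<dots> = real M ^ L * (\<Sum>y\<in>B. ?m y ^ (L + 1))"
    using assms(3,4) by simp
  finally show ?thesis .
qed

text \<open>With i.i.d. input letters, both the inner mean and the outer sum of the random coding
  bound factor over the positions.\<close>

lemma eps_n_le:
  assumes W: "is_channel W" and P: "is_distr P" and "1 \<le> L" "L \<le> M"
  shows "eps_n L M n W
    \<le> real M ^ L * (\<Sum>y\<in>UNIV. (\<Sum>x\<in>UNIV. P x * W x y powr (1 / real (L + 1))) ^ (L + 1)) ^ n"
proof -
  let ?s = "1 / real (L + 1)" and ?Pn = "\<lambda>xs. \<Prod>j<n. P (xs ! j)"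
  have Pn: "?Pn xs \<ge> 0" for xs :: "'a list"
    using P by (intro prod_nonneg) (auto simp: is_distr_def)
  have Pn_sum: "(\<Sum>xs\<in>{xs. length xs = n}. ?Pn xs) = 1"
    using sum_words_prod[where n = n and f = "\<lambda>_. P"] P by (simp add: is_distr_def)
  have "(\<Sum>xs\<in>{xs. length xs = n}. ?Pn xs * channel_power W xs ys powr ?s)
      = (\<Prod>j<n. \<Sum>x\<in>UNIV. P x * W x (ys ! j) powr ?s)" if "length ys = n" for ys
  proof -
    have "(\<Sum>xs\<in>{xs. length xs = n}. ?Pn xs * channel_power W xs ys powr ?s)
        = (\<Sum>xs\<in>{xs. length xs = n}. \<Prod>j<n. P (xs ! j) * W (xs ! j) (ys ! j) powr ?s)"
      using that by (intro sum.cong) (auto simp: channel_power_eq_prod prod_powr_distrib prod.distrib)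
    then show ?thesis using sum_words_prod[where n = n and f = "\<lambda>j x. P x * W x (ys ! j) powr ?s"] by simp
  qed
  then have "(\<Sum>ys\<in>{ys. length ys = n}.
        (\<Sum>xs\<in>{xs. length xs = n}. ?Pn xs * channel_power W xs ys powr ?s) ^ (L + 1))
      = (\<Sum>ys\<in>{ys. length ys = n}. \<Prod>j<n. (\<Sum>x\<in>UNIV. P x * W x (ys ! j) powr ?s) ^ (L + 1))"
    by (intro sum.cong) (auto simp: prod_power_distrib prod.distrib)
  also have "\<dots> = (\<Sum>y\<in>UNIV. (\<Sum>x\<in>UNIV. P x * W x y powr ?s) ^ (L + 1)) ^ n"
    using sum_words_prod[where n = n and f = "\<lambda>_ y. (\<Sum>x\<in>UNIV. P x * W x y powr ?s) ^ (L + 1)"] by simp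
  finally have eq: "(\<Sum>ys\<in>{ys. length ys = n}.
        (\<Sum>xs\<in>{xs. length xs = n}. ?Pn xs * channel_power W xs ys powr ?s) ^ (L + 1))
      = (\<Sum>y\<in>UNIV. (\<Sum>x\<in>UNIV. P x * W x y powr ?s) ^ (L + 1)) ^ n" .
  have "eps_n L M n W \<le> real M ^ L * (\<Sum>ys\<in>{ys. length ys = n}.
      (\<Sum>xs\<in>{xs. length xs = n}. ?Pn xs * channel_power W xs ys powr ?s) ^ (L + 1))"
    unfolding eps_n_def
    using assms Pn Pn_sum
    by (intro random_coding_bound[where P = ?Pn]) (auto intro: channel_power_nonneg)
  then show ?thesis unfolding eq .
qed

section \<open>Converse\<close>

text \<open>A pointwise form of the variational lower bound for divergence. Here \<open>g\<close> is
  the conditional error probability, and the test function is \<open>1 / (2 * \<eta>)\<close> on an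
  error and \<open>1 / 2\<close> on success, so that its mean under the true channel is at most 1 as
  soon as the error is at most \<open>\<eta>\<close>.\<close>

lemma log_likelihood_tilt:
  fixes q v g k \<eta> :: real
  assumes "0 \<le> q" "0 \<le> v" "0 \<le> g" "g \<le> 1" "0 < \<eta>" and k: "0 < q \<Longrightarrow> 0 < v \<and> k = ln (q / v)"
  shows "q * (1 - ln 2 - g * ln \<eta>) - v * (g / (2 * \<eta>) + (1 - g) / 2) \<le> q * k"
proof (cases "q = 0")
  case True
  then show ?thesis using assms by simp
next
  case False
  then have "0 < q" "0 < v" "k = ln (q / v)" using assms by auto
  \<comment> \<open>This is \<open>ln t \<le> t - 1\<close> at \<open>t = v * c / q\<close>.\<close>
  have tilt: "q * (1 + ln c) - v * c \<le> q * k" if "0 < c" for c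
  proof -
    have "ln (v * c / q) \<le> v * c / q - 1"
      using \<open>0 < q\<close> \<open>0 < v\<close> that by (intro ln_le_minus_one) auto
    moreover have "ln (v * c / q) = ln c - k"
      using \<open>0 < q\<close> \<open>0 < v\<close> that \<open>k = _\<close> by (simp add: ln_div ln_mult)
    ultimately have "q * (1 + ln c - k) \<le> q * (v * c / q)"
      using \<open>0 < q\<close> by (intro mult_left_mono) auto
    then show ?thesis using \<open>0 < q\<close> by (simp add: algebra_simps)
  qed
  \<comment> \<open>The inequality \<open>tilt\<close> at the two values of the test function, mixed
    with weights \<open>g\<close> and \<open>1 - g\<close>.\<close>
  have "g * (q * (1 + ln (1 / (2 * \<eta>))) - v * (1 / (2 * \<eta>)))
      + (1 - g) * (q * (1 + ln (1 / 2)) - v * (1 / 2)) \<le> g * (q * k) + (1 - g) * (q * k)"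
    using assms by (intro add_mono mult_left_mono tilt) auto
  then show ?thesis using \<open>0 < \<eta>\<close> by (simp add: ln_div ln_mult algebra_simps)
qed

text \<open>If the channel output is replaced by an independent variable with distribution \<open>Q\<close>, then every
  list code has error probability \<open>1 - L / M\<close>; \<open>K\<close> is the log-likelihood ratio of the two channels,
  constrained only where it contributes to the divergence.\<close>

lemma list_code_converse:
  assumes fin: "finite A" "finite B" and code: "is_list_code L M A B Enc Dec" and "L \<le> M" "0 < M"
    and V: "\<And>x y. x \<in> A \<Longrightarrow> y \<in> B \<Longrightarrow> V x y \<ge> 0" "\<And>x. x \<in> A \<Longrightarrow> (\<Sum>y\<in>B. V x y) = 1"
    and Q: "\<And>y. y \<in> B \<Longrightarrow> Q y \<ge> 0" "(\<Sum>y\<in>B. Q y) = 1"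
    and K: "\<And>w x y. w < M \<Longrightarrow> x \<in> A \<Longrightarrow> y \<in> B \<Longrightarrow> Enc w x > 0 \<Longrightarrow> Q y > 0 \<Longrightarrow>
      V x y > 0 \<and> K x y = ln (Q y / V x y)"
    and \<eta>: "0 < \<eta>" "list_code_error L M A B V Enc Dec \<le> \<eta>"
  shows "(1 - L / M) * (- ln \<eta>)
    \<le> (\<Sum>x\<in>A. (1 / M * (\<Sum>w<M. Enc w x)) * (\<Sum>y\<in>B. Q y * K x y)) + ln 2"
proof -
  \<comment> \<open>\<open>e w y\<close> is the probability that the list for output
    \<open>y\<close> misses \<open>w\<close>. \<open>E f\<close> is \<open>M\<close> times a mean
    over message and input only; the weights of the outputs are supplied by
    \<open>f\<close>.\<close>
  define e where "e w y = (\<Sum>S\<in>{S \<in> list_subsets L M. w \<notin> S}. Dec y S)" for w y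
  define E where "E f = (\<Sum>w<M. \<Sum>x\<in>A. \<Sum>y\<in>B. Enc w x * f w x y)" for f :: "nat \<Rightarrow> 'a \<Rightarrow> 'b \<Rightarrow> real"
  have Enc: "Enc w x \<ge> 0" if "w < M" "x \<in> A" for w x
    using code that by (auto simp: is_list_code_def)
  have Enc_sum: "(\<Sum>x\<in>A. Enc w x) = 1" if "w < M" for w
    using code that by (auto simp: is_list_code_def)
  have Dec: "Dec y S \<ge> 0" if "y \<in> B" "S \<in> list_subsets L M" for y S
    using code that by (auto simp: is_list_code_def)
  have Dec_sum: "(\<Sum>S\<in>list_subsets L M. Dec y S) = 1" if "y \<in> B" for y
    using code that by (auto simp: is_list_code_def)
  have e_nonneg: "0 \<le> e w y" if "y \<in> B" for w y
    unfolding e_def using Dec that by (intro sum_nonneg) auto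
  have e_le: "e w y \<le> 1" if "y \<in> B" for w y
    unfolding e_def Dec_sum[OF that, symmetric] using Dec that by (intro sum_mono2) auto
  \<comment> \<open>Every list omits exactly \<open>M - L\<close> messages, whatever the output;
    this is the source of the error probability \<open>1 - L / M\<close> under
    \<open>Q\<close>.\<close>
  have e_sum: "(\<Sum>w<M. e w y) = real M - real L" if "y \<in> B" for y
  proof -
    have "(\<Sum>w<M. e w y) = (\<Sum>w<M. \<Sum>S\<in>list_subsets L M. if w \<notin> S then Dec y S else 0)"
      unfolding e_def by (intro sum.cong refl sum.inter_filter) simp
    also have "\<dots> = (\<Sum>S\<in>list_subsets L M. \<Sum>w<M. if w \<notin> S then Dec y S else 0)"
      by (rule sum.swap)
    also have "\<dots> = (\<Sum>S\<in>list_subsets L M. (real M - real L) * Dec y S)"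
    proof (intro sum.cong refl)
      fix S assume "S \<in> list_subsets L M"
      then have S: "S \<subseteq> {..<M}" "card S = L" by (auto simp: list_subsets_def)
      have "(\<Sum>w<M. if w \<notin> S then Dec y S else 0) = (\<Sum>w\<in>{..<M} - S. Dec y S)"
        by (simp add: sum.If_cases Diff_eq Collect_neg_eq)
      also have "\<dots> = (real M - real L) * Dec y S"
        using S \<open>L \<le> M\<close> by (simp add: card_Diff_subset finite_subset of_nat_diff)
      finally show "(\<Sum>w<M. if w \<notin> S then Dec y S else 0) = (real M - real L) * Dec y S" .
    qed
    finally show ?thesis using Dec_sum[OF that] by (simp flip: sum_distrib_left)
  qed
  have lin: "E (\<lambda>w x y. a * f w x y + b * g w x y) = a * E f + b * E g" for a b f g
    by (simp add: E_def sum.distrib sum_distrib_left algebra_simps)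
  have E_Q: "E (\<lambda>w x y. Q y) = M"
    by (simp add: E_def Q(2) Enc_sum flip: sum_distrib_left)
  have E_V: "E (\<lambda>w x y. V x y) = M"
    by (simp add: E_def V(2) Enc_sum flip: sum_distrib_left)
  have E_Qe: "E (\<lambda>w x y. Q y * e w y) = real M - real L"
  proof -
    have "E (\<lambda>w x y. Q y * e w y) = (\<Sum>w<M. \<Sum>y\<in>B. Q y * e w y)"
      by (simp add: E_def Enc_sum flip: sum_distrib_left sum_distrib_right)
    also have "\<dots> = (\<Sum>y\<in>B. Q y * (\<Sum>w<M. e w y))"
      by (subst sum.swap) (simp add: sum_distrib_left)
    also have "\<dots> = real M - real L"
      using Q(2) by (simp add: e_sum flip: sum_distrib_right)
    finally show ?thesis .
  qed
  have E_Ve: "E (\<lambda>w x y. V x y * e w y) = M * list_code_error L M A B V Enc Dec"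
    using \<open>0 < M\<close> by (simp add: E_def list_code_error_def e_def mult_ac)
  have "E (\<lambda>w x y. Q y * (1 - ln 2 - e w y * ln \<eta>) - V x y * (e w y / (2 * \<eta>) + (1 - e w y) / 2))
      \<le> E (\<lambda>w x y. Q y * K x y)"
    unfolding E_def
  proof (intro sum_mono)
    fix w x y assume wxy: "w \<in> {..<M}" "x \<in> A" "y \<in> B"
    show "Enc w x * (Q y * (1 - ln 2 - e w y * ln \<eta>) - V x y * (e w y / (2 * \<eta>) + (1 - e w y) / 2))
        \<le> Enc w x * (Q y * K x y)"
    proof (cases "Enc w x = 0")
      case False
      then have "0 < Enc w x" using Enc[of w x] wxy by auto
      then show ?thesis
        using wxy \<eta>(1) V Q e_nonneg e_le K[of w x y]
        by (intro mult_left_mono log_likelihood_tilt) auto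
    qed simp
  qed
  \<comment> \<open>Regrouped as a combination of \<open>Q\<close>, \<open>Q * e\<close>,
    \<open>V\<close> and \<open>V * e\<close>, whose values under \<open>E\<close> are
    known.\<close>
  also have "(\<lambda>w x y. Q y * (1 - ln 2 - e w y * ln \<eta>) - V x y * (e w y / (2 * \<eta>) + (1 - e w y) / 2))
      = (\<lambda>w x y. 1 * ((1 - ln 2) * Q y + (- ln \<eta>) * (Q y * e w y))
          + (-1) * ((1 / 2) * V x y + (1 / (2 * \<eta>) - 1 / 2) * (V x y * e w y)))"
    by (intro ext) (simp add: field_simps \<eta>(1))
  also have "E \<dots> = 1 * ((1 - ln 2) * M + (- ln \<eta>) * (real M - real L))
      + (-1) * ((1 / 2) * M + (1 / (2 * \<eta>) - 1 / 2) * (M * list_code_error L M A B V Enc Dec))"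
    by (simp only: lin E_Q E_V E_Qe E_Ve)
  also have "E (\<lambda>w x y. Q y * K x y)
      = M * (\<Sum>x\<in>A. (1 / M * (\<Sum>w<M. Enc w x)) * (\<Sum>y\<in>B. Q y * K x y))"
  proof -
    have "E (\<lambda>w x y. Q y * K x y) = (\<Sum>x\<in>A. (\<Sum>w<M. Enc w x) * (\<Sum>y\<in>B. Q y * K x y))"
      unfolding E_def by (subst sum.swap) (simp add: sum_distrib_left[symmetric] sum_distrib_right)
    also have "\<dots> = (\<Sum>x\<in>A. M * ((1 / M * (\<Sum>w<M. Enc w x)) * (\<Sum>y\<in>B. Q y * K x y)))"
      using \<open>0 < M\<close> by (intro sum.cong refl) simp
    finally show ?thesis unfolding sum_distrib_left[of "real M", symmetric] .
  qed
  finally have main: "M * (1 - ln 2) - ln \<eta> * (real M - real L)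
      - M * (1 / 2 + (1 / (2 * \<eta>) - 1 / 2) * list_code_error L M A B V Enc Dec)
      \<le> M * (\<Sum>x\<in>A. (1 / M * (\<Sum>w<M. Enc w x)) * (\<Sum>y\<in>B. Q y * K x y))"
    by (simp add: algebra_simps)
  \<comment> \<open>Next, the mean of the test function under the true channel is shown to be at
    most 1.\<close>
  have "list_code_error L M A B V Enc Dec / (2 * \<eta>) \<le> 1 / 2"
    using \<eta> by (simp add: field_simps)
  moreover have "0 \<le> list_code_error L M A B V Enc Dec"
    using list_code_error_nonneg[OF code, of V] V(1) by simp
  ultimately have "1 / 2 + (1 / (2 * \<eta>) - 1 / 2) * list_code_error L M A B V Enc Dec \<le> 1"
    by (simp add: algebra_simps)
  then have "M * (1 / 2 + (1 / (2 * \<eta>) - 1 / 2) * list_code_error L M A B V Enc Dec) \<le> real M * 1"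
    by (intro mult_left_mono) auto
  with main have "(real M - real L) * (- ln \<eta>)
      \<le> M * ((\<Sum>x\<in>A. (1 / M * (\<Sum>w<M. Enc w x)) * (\<Sum>y\<in>B. Q y * K x y)) + ln 2)"
    by (simp add: algebra_simps)
  then have "(real M - real L) * (- ln \<eta>) / M
      \<le> (\<Sum>x\<in>A. (1 / M * (\<Sum>w<M. Enc w x)) * (\<Sum>y\<in>B. Q y * K x y)) + ln 2"
    using \<open>0 < M\<close> by (subst pos_divide_le_eq) (simp_all add: mult.commute)
  moreover have "(real M - real L) * (- ln \<eta>) / M = (1 - L / M) * (- ln \<eta>)"
    using \<open>0 < M\<close> by (simp add: field_simps)
  ultimately show ?thesis by simp
qed

section \<open>Product divergences and the umlaut information\<close>

lemma KL_div_product: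
  assumes "is_distr P" "is_distr Q" and ac: "\<And>x y. P x > 0 \<Longrightarrow> Q y > 0 \<Longrightarrow> W x y \<noteq> 0"
  shows "KL_div (\<lambda>(x, y). P x * Q y) (\<lambda>(x, y). P x * W x y)
    = ereal (\<Sum>x\<in>UNIV. P x * (\<Sum>y\<in>UNIV. Q y * ln (Q y / W x y)))"
proof -
  let ?P = "\<lambda>(x, y). P x * Q y" and ?W = "\<lambda>(x, y). P x * W x y"
  have nonneg: "P x \<ge> 0" "Q y \<ge> 0" for x y using assms by (auto simp: is_distr_def)
  have ac': "\<not> (\<exists>z. ?P z > 0 \<and> ?W z = 0)"
  proof clarify
    fix x y assume "P x * Q y > 0" "P x * W x y = 0"
    moreover from this have "P x > 0" "Q y > 0"
      using nonneg(1)[of x] nonneg(2)[of y] by (auto simp: zero_less_mult_iff)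
    ultimately show False using ac[of x y] by simp
  qed
  have "(\<Sum>x\<in>UNIV. P x * (\<Sum>y\<in>UNIV. Q y * ln (Q y / W x y)))
      = (\<Sum>x\<in>UNIV. \<Sum>y\<in>UNIV. ?P (x, y) * ln (?P (x, y) / ?W (x, y)))"
    unfolding sum_distrib_left
  proof (intro sum.cong refl)
    show "P x * (Q y * ln (Q y / W x y)) = ?P (x, y) * ln (?P (x, y) / ?W (x, y))" for x y
      by (cases "P x = 0") simp_all
  qed
  also have "\<dots> = (\<Sum>z\<in>UNIV. ?P z * ln (?P z / ?W z))"
    by (simp add: sum.cartesian_product case_prod_unfold)
  also have "\<dots> = (\<Sum>z\<in>{z. ?P z > 0}. ?P z * ln (?P z / ?W z))"
  proof (intro sum.mono_neutral_right ballI)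
    fix z assume z: "z \<in> UNIV - {z. ?P z > 0}"
    have "?P z \<ge> 0" using nonneg by (cases z) simp
    then show "?P z * ln (?P z / ?W z) = 0" using z by auto
  qed auto
  finally show ?thesis unfolding KL_div_def if_not_P[OF ac'] by simp
qed

text \<open>A divergence below a real number is finite, which forces absolute continuity and makes
  the explicit sum available.\<close>

lemma KL_div_product_less_ereal:
  assumes "is_distr P" "is_distr Q"
    and less: "KL_div (\<lambda>(x, y). P x * Q y) (\<lambda>(x, y). P x * W x y) < ereal u"
  shows "P x > 0 \<Longrightarrow> Q y > 0 \<Longrightarrow> W x y \<noteq> 0"
    and "(\<Sum>x\<in>UNIV. P x * (\<Sum>y\<in>UNIV. Q y * ln (Q y / W x y))) \<le> u"
proof -
  have "\<not> (\<exists>z. (case z of (x, y) \<Rightarrow> P x * Q y) > 0 \<and> (case z of (x, y) \<Rightarrow> P x * W x y) = 0)"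
    using less by (auto simp: KL_div_def split: if_splits)
  then have ac: "W x y \<noteq> 0" if "P x > 0" "Q y > 0" for x y
    using that by auto
  then show "P x > 0 \<Longrightarrow> Q y > 0 \<Longrightarrow> W x y \<noteq> 0" .
  show "(\<Sum>x\<in>UNIV. P x * (\<Sum>y\<in>UNIV. Q y * ln (Q y / W x y))) \<le> u"
    using less KL_div_product[of P Q W, OF assms(1,2)] ac by simp
qed

text \<open>For the given \<open>P\<close> the infimum over \<open>Q\<close> is also below
  \<open>u\<close>. Being strictly below a real number, it yields a witness \<open>Q\<close> of
  finite divergence.\<close>

lemma umlaut_info_less_ereal:
  assumes "is_distr P" "umlaut_info W < ereal u"
  obtains Q where "is_distr Q" "\<And>x y. P x > 0 \<Longrightarrow> Q y > 0 \<Longrightarrow> W x y \<noteq> 0"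
    "(\<Sum>x\<in>UNIV. P x * (\<Sum>y\<in>UNIV. Q y * ln (Q y / W x y))) \<le> u"
proof -
  have "(INF Q\<in>{Q. is_distr Q}. KL_div (\<lambda>(x, y). P x * Q y) (\<lambda>(x, y). P x * W x y)) < ereal u"
    using assms(2) unfolding umlaut_info_def
    by (rule le_less_trans[OF SUP_upper, rotated]) (simp add: assms(1))
  then have "\<exists>Q\<in>{Q. is_distr Q}. KL_div (\<lambda>(x, y). P x * Q y) (\<lambda>(x, y). P x * W x y) < ereal u"
    by (simp only: INF_less_iff)
  then obtain Q where Q: "is_distr Q" "KL_div (\<lambda>(x, y). P x * Q y) (\<lambda>(x, y). P x * W x y) < ereal u"
    by (elim bexE) simp
  show ?thesis by (rule that[OF Q(1) KL_div_product_less_ereal[OF assms(1) Q]])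
qed

text \<open>Grouping words by their letter at position \<open>i\<close> gives the law of one letter
  of a random codeword.\<close>

lemma marginal_distr:
  fixes Pn :: "'a::finite list \<Rightarrow> real"
  assumes "\<And>xs. length xs = n \<Longrightarrow> Pn xs \<ge> 0" "(\<Sum>xs\<in>{xs. length xs = n}. Pn xs) = 1"
  shows "is_distr (\<lambda>x. \<Sum>xs\<in>{xs. length xs = n \<and> xs ! i = x}. Pn xs)"
    and "(\<Sum>xs\<in>{xs. length xs = n}. Pn xs * h (xs ! i))
      = (\<Sum>x\<in>UNIV. (\<Sum>xs\<in>{xs. length xs = n \<and> xs ! i = x}. Pn xs) * h x)"
proof -
  have marginal: "(\<Sum>xs\<in>{xs. length xs = n}. Pn xs * h (xs ! i))
      = (\<Sum>x\<in>UNIV. (\<Sum>xs\<in>{xs. length xs = n \<and> xs ! i = x}. Pn xs) * h x)" for h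
  proof -
    have "(\<Sum>xs\<in>{xs. length xs = n}. Pn xs * h (xs ! i))
        = (\<Sum>x\<in>UNIV. \<Sum>xs\<in>{xs \<in> {xs. length xs = n}. xs ! i = x}. Pn xs * h (xs ! i))"
      by (intro sum.group[symmetric]) auto
    then show ?thesis by (simp add: sum_distrib_right)
  qed
  then show "(\<Sum>xs\<in>{xs. length xs = n}. Pn xs * h (xs ! i))
      = (\<Sum>x\<in>UNIV. (\<Sum>xs\<in>{xs. length xs = n \<and> xs ! i = x}. Pn xs) * h x)" .
  show "is_distr (\<lambda>x. \<Sum>xs\<in>{xs. length xs = n \<and> xs ! i = x}. Pn xs)"
    using marginal[of "\<lambda>_. 1"] assms by (auto simp: is_distr_def intro: sum_nonneg)
qed

text \<open>The reference output distribution is a product whose \<open>i\<close>-th factor is nearly optimal for the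
  \<open>i\<close>-th marginal of the codebook; this makes a minimax theorem for the umlaut information
  unnecessary.\<close>

lemma list_code_error_channel_power:
  assumes W: "is_channel W" and u: "umlaut_info W < ereal u" and "L \<le> M" "0 < M"
    and code: "is_list_code L M {xs. length xs = n} {ys. length ys = n} Enc Dec"
    and \<eta>: "0 < \<eta>" "list_code_error L M {xs. length xs = n} {ys. length ys = n} (channel_power W) Enc Dec \<le> \<eta>"
  shows "(1 - L / M) * (- ln \<eta>) \<le> n * u + ln 2"
proof -
  let ?A = "{xs::'a list. length xs = n}" and ?B = "{ys::'b list. length ys = n}"
  \<comment> \<open>The law of the codeword of a uniform message; \<open>P i\<close> is its marginal
    at position \<open>i\<close>.\<close>
  define Pn where "Pn xs = 1 / M * (\<Sum>w<M. Enc w xs)" for xs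
  define P where "P i x = (\<Sum>xs\<in>{xs. length xs = n \<and> xs ! i = x}. Pn xs)" for i x
  have Enc: "Enc w xs \<ge> 0" if "w < M" "length xs = n" for w xs
    using code that by (auto simp: is_list_code_def)
  have Pn: "Pn xs \<ge> 0" if "length xs = n" for xs
    unfolding Pn_def using Enc that by (intro mult_nonneg_nonneg sum_nonneg) auto
  have Pn_sum: "(\<Sum>xs\<in>?A. Pn xs) = 1"
  proof -
    have "(\<Sum>xs\<in>?A. Pn xs) = 1 / M * (\<Sum>w<M. \<Sum>xs\<in>?A. Enc w xs)"
      unfolding Pn_def sum_distrib_left[symmetric] by (subst sum.swap) simp
    also have "\<dots> = 1" using code \<open>0 < M\<close> by (simp add: is_list_code_def)
    finally show ?thesis .
  qed
  have P: "is_distr (P i)" for i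
    using marginal_distr(1)[OF Pn Pn_sum, of i] unfolding P_def by simp
  have "\<forall>i. \<exists>Q. is_distr Q \<and> (\<forall>x y. P i x > 0 \<longrightarrow> Q y > 0 \<longrightarrow> W x y \<noteq> 0) \<and>
      (\<Sum>x\<in>UNIV. P i x * (\<Sum>y\<in>UNIV. Q y * ln (Q y / W x y))) \<le> u"
  proof
    fix i
    show "\<exists>Q. is_distr Q \<and> (\<forall>x y. P i x > 0 \<longrightarrow> Q y > 0 \<longrightarrow> W x y \<noteq> 0) \<and>
        (\<Sum>x\<in>UNIV. P i x * (\<Sum>y\<in>UNIV. Q y * ln (Q y / W x y))) \<le> u"
      by (rule umlaut_info_less_ereal[OF P[of i] u]) blast
  qed
  from choice[OF this] obtain Q where Q: "\<And>i. is_distr (Q i)"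
      and ac: "\<And>i x y. P i x > 0 \<Longrightarrow> Q i y > 0 \<Longrightarrow> W x y \<noteq> 0"
      and KL: "\<And>i. (\<Sum>x\<in>UNIV. P i x * (\<Sum>y\<in>UNIV. Q i y * ln (Q i y / W x y))) \<le> u"
    by blast
  define K where "K xs ys = (\<Sum>i<n. ln (Q i (ys ! i) / W (xs ! i) (ys ! i)))" for xs ys
  have Q_nonneg: "Q i y \<ge> 0" and Q_sum: "(\<Sum>y\<in>UNIV. Q i y) = 1" for i y
    using Q[of i] by (auto simp: is_distr_def)
  have "(1 - L / M) * (- ln \<eta>)
      \<le> (\<Sum>xs\<in>?A. (1 / M * (\<Sum>w<M. Enc w xs)) * (\<Sum>ys\<in>?B. (\<Prod>i<n. Q i (ys ! i)) * K xs ys)) + ln 2"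
  proof (rule list_code_converse[OF _ _ code \<open>L \<le> M\<close> \<open>0 < M\<close> _ _ _ _ _ \<eta>])
    show "(\<Sum>ys\<in>?B. \<Prod>i<n. Q i (ys ! i)) = 1"
      using sum_words_prod[where n = n and f = Q] Q_sum by simp
    fix w xs ys
    assume w: "w < M" and xs: "xs \<in> ?A" and ys: "ys \<in> ?B" and "Enc w xs > 0"
      and "(\<Prod>i<n. Q i (ys ! i)) > 0"
    have "Pn xs > 0"
    proof -
      have "(\<Sum>w<M. Enc w xs) > 0"
        using w \<open>Enc w xs > 0\<close> Enc xs by (intro sum_pos2[of _ w]) auto
      then show ?thesis using \<open>0 < M\<close> by (simp add: Pn_def)
    qed
    have Q_pos: "Q i (ys ! i) > 0" if "i < n" for i
    proof -
      have "Q i (ys ! i) \<noteq> 0"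
      proof
        assume "Q i (ys ! i) = 0"
        then have "(\<Prod>i<n. Q i (ys ! i)) = 0" using that by (intro prod_zero) auto
        with \<open>(\<Prod>i<n. Q i (ys ! i)) > 0\<close> show False by linarith
      qed
      then show ?thesis using Q_nonneg[of i "ys ! i"] by simp
    qed
    \<comment> \<open>\<open>Pn xs\<close> is a summand of the marginal \<open>P i (xs ! i)\<close>,
      which is therefore positive, and absolute continuity at position \<open>i\<close>
      applies.\<close>
    have W_pos: "W (xs ! i) (ys ! i) > 0" if "i < n" for i
    proof -
      have "Pn xs \<le> P i (xs ! i)"
        unfolding P_def using xs Pn by (intro member_le_sum) (auto intro: finite_subset[OF _ finite_words])
      then have "W (xs ! i) (ys ! i) \<noteq> 0"
        using \<open>Pn xs > 0\<close> Q_pos[OF that] by (intro ac[of i]) auto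
      then show ?thesis using is_channel_nonneg[OF W, of "xs ! i" "ys ! i"] by simp
    qed
    have "Q i (ys ! i) / W (xs ! i) (ys ! i) \<noteq> 0" if "i < n" for i
      using Q_pos[OF that] W_pos[OF that] by simp
    then have "K xs ys = ln (\<Prod>i<n. Q i (ys ! i) / W (xs ! i) (ys ! i))"
      unfolding K_def by (intro ln_prod[symmetric]) simp_all
    then show "channel_power W xs ys > 0 \<and> K xs ys = ln ((\<Prod>i<n. Q i (ys ! i)) / channel_power W xs ys)"
      using xs ys W_pos by (auto simp: channel_power_eq_prod prod_dividef intro!: prod_pos)
  qed (use Q_nonneg in \<open>auto intro: prod_nonneg channel_power_nonneg[OF W] channel_power_sum[OF W]\<close>)
  \<comment> \<open>The log-likelihood ratio is additive over letters, so only the marginals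
    \<open>P i\<close> of the codeword law enter.\<close>
  also have "(\<Sum>xs\<in>?A. (1 / M * (\<Sum>w<M. Enc w xs)) * (\<Sum>ys\<in>?B. (\<Prod>i<n. Q i (ys ! i)) * K xs ys))
      = (\<Sum>i<n. \<Sum>x\<in>UNIV. P i x * (\<Sum>y\<in>UNIV. Q i y * ln (Q i y / W x y)))"
  proof -
    have "(\<Sum>ys\<in>?B. (\<Prod>i<n. Q i (ys ! i)) * K xs ys)
        = (\<Sum>i<n. \<Sum>y\<in>UNIV. Q i y * ln (Q i y / W (xs ! i) y))" for xs
    proof -
      have "(\<Sum>ys\<in>?B. (\<Prod>i<n. Q i (ys ! i)) * K xs ys)
          = (\<Sum>i<n. \<Sum>ys\<in>?B. (\<Prod>j<n. Q j (ys ! j)) * ln (Q i (ys ! i) / W (xs ! i) (ys ! i)))"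
        unfolding K_def sum_distrib_left by (rule sum.swap)
      also have "\<dots> = (\<Sum>i<n. \<Sum>y\<in>UNIV. Q i y * ln (Q i y / W (xs ! i) y))"
        using Q_sum by (intro sum.cong refl sum_words_prod_nth[where h = "\<lambda>y. ln (Q _ y / W _ y)"]) auto
      finally show ?thesis .
    qed
    then have "(\<Sum>xs\<in>?A. (1 / M * (\<Sum>w<M. Enc w xs)) * (\<Sum>ys\<in>?B. (\<Prod>i<n. Q i (ys ! i)) * K xs ys))
        = (\<Sum>xs\<in>?A. \<Sum>i<n. Pn xs * (\<Sum>y\<in>UNIV. Q i y * ln (Q i y / W (xs ! i) y)))"
      by (simp add: Pn_def sum_distrib_left)
    also have "\<dots> = (\<Sum>i<n. \<Sum>xs\<in>?A. Pn xs * (\<Sum>y\<in>UNIV. Q i y * ln (Q i y / W (xs ! i) y)))"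
      by (rule sum.swap)
    also have "\<dots> = (\<Sum>i<n. \<Sum>x\<in>UNIV. P i x * (\<Sum>y\<in>UNIV. Q i y * ln (Q i y / W x y)))"
      unfolding P_def by (intro sum.cong refl marginal_distr(2)[OF Pn Pn_sum])
    finally show ?thesis .
  qed
  also have "\<dots> \<le> (\<Sum>i<n. u)" by (intro sum_mono KL)
  finally show ?thesis by simp
qed

lemma eps_n_ge:
  assumes W: "is_channel W" and u: "umlaut_info W < ereal u" and "L < M"
  shows "exp (- ((n * u + ln 2) / (1 - L / M))) \<le> eps_n L M n W"
  unfolding eps_n_def min_list_error_def
proof (rule cInf_greatest)
  let ?A = "{xs::'a list. length xs = n}" and ?B = "{ys::'b list. length ys = n}"
  show "{list_code_error L M ?A ?B (channel_power W) Enc Dec |Enc Dec. is_list_code L M ?A ?B Enc Dec} \<noteq> {}"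
    using ex_is_list_code[of ?A ?B L M] words_nonempty \<open>L < M\<close> by auto
  fix e assume "e \<in> {list_code_error L M ?A ?B (channel_power W) Enc Dec |Enc Dec. is_list_code L M ?A ?B Enc Dec}"
  then obtain Enc Dec where code: "is_list_code L M ?A ?B Enc Dec"
      and e: "e = list_code_error L M ?A ?B (channel_power W) Enc Dec"
    by blast
  have "e \<ge> 0"
    unfolding e by (intro list_code_error_nonneg[OF code]) (auto intro: channel_power_nonneg[OF W])
  define x where "x = exp (- ((n * u + ln 2) / (1 - L / M)))"
  have "x \<le> e"
  proof (rule ccontr)
    assume "\<not> x \<le> e"
    \<comment> \<open>\<open>e\<close> may be 0, where its logarithm says nothing; the midpoint is
      positive, at least \<open>e\<close> and still below \<open>x\<close>.\<close>
    define \<eta> where "\<eta> = (e + x) / 2"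
    have "0 < x" by (simp add: x_def)
    then have \<eta>: "0 < \<eta>" "e \<le> \<eta>" "\<eta> < x"
      using \<open>\<not> x \<le> e\<close> \<open>e \<ge> 0\<close> by (simp_all add: \<eta>_def)
    have pos: "1 - L / M > 0" using \<open>L < M\<close> by simp
    have "(1 - L / M) * (- ln \<eta>) \<le> n * u + ln 2"
      using list_code_error_channel_power[OF W u _ _ code \<eta>(1)] \<eta>(2) \<open>L < M\<close> unfolding e by simp
    then have "- ln \<eta> \<le> (n * u + ln 2) / (1 - L / M)"
      using pos by (simp add: pos_le_divide_eq mult.commute)
    then have "ln x \<le> ln \<eta>" by (simp add: x_def)
    then show False using \<eta>(1,3) by simp
  qed
  then show "exp (- ((n * u + ln 2) / (1 - L / M))) \<le> e" by (simp add: x_def)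
qed

section \<open>Large lists\<close>

text \<open>If \<open>v\<close> vanishes at a point \<open>z\<close> of positive mass, the mean is
  at most \<open>1 - P z\<close> and its powers tend to 0. Otherwise the logarithm of the mean of
  \<open>v powr s\<close>, divided by \<open>s\<close>, tends to its derivative at 0, the
  \<open>P\<close>-mean of \<open>ln v\<close>; then \<open>s = 1 / (L + 1)\<close>.\<close>

lemma power_mean_tendsto_geometric_mean:
  fixes v :: "'a::finite \<Rightarrow> real"
  assumes P: "is_distr P" and v: "\<And>x. 0 \<le> v x" "\<And>x. v x \<le> 1"
  shows "(\<lambda>L. (\<Sum>x\<in>UNIV. P x * v x powr (1 / real (L + 1))) ^ (L + 1))
    \<longlonglongrightarrow> (\<Prod>x\<in>{x. P x > 0}. v x powr P x)"
proof (cases "\<exists>x. P x > 0 \<and> v x = 0")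
  case True
  then obtain z where z: "P z > 0" "v z = 0" by auto
  have P_nonneg: "P x \<ge> 0" for x using P by (simp add: is_distr_def)
  have le: "(\<Sum>x\<in>UNIV. P x * v x powr s) \<le> 1 - P z" if "s \<ge> 0" for s
  proof -
    have "(\<Sum>x\<in>UNIV. P x * v x powr s) = (\<Sum>x\<in>UNIV - {z}. P x * v x powr s)"
      using z(2) by (intro sum.mono_neutral_right) auto
    also have "\<dots> \<le> (\<Sum>x\<in>UNIV - {z}. P x * 1)"
      using P_nonneg v that by (intro sum_mono mult_left_mono powr_le1) auto
    also have "\<dots> = 1 - P z" using P by (simp add: sum_diff1 is_distr_def)
    finally show ?thesis .
  qed
  have lim: "(\<lambda>L. (1 - P z) ^ (L + 1)) \<longlonglongrightarrow> 0"
    using LIMSEQ_Suc[OF LIMSEQ_power_zero[of "1 - P z"]] z(1) is_distr_le_1[OF P, of z] by simp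
  have "(\<lambda>L. (\<Sum>x\<in>UNIV. P x * v x powr (1 / real (L + 1))) ^ (L + 1)) \<longlonglongrightarrow> 0"
  proof (rule tendsto_sandwich[OF _ _ tendsto_const lim])
    show "\<forall>\<^sub>F L in sequentially. 0 \<le> (\<Sum>x\<in>UNIV. P x * v x powr (1 / real (L + 1))) ^ (L + 1)"
      using P_nonneg by (intro always_eventually allI zero_le_power sum_nonneg) auto
    show "\<forall>\<^sub>F L in sequentially.
        (\<Sum>x\<in>UNIV. P x * v x powr (1 / real (L + 1))) ^ (L + 1) \<le> (1 - P z) ^ (L + 1)"
      using P_nonneg by (intro always_eventually allI power_mono le sum_nonneg) auto
  qed
  moreover have "(\<Prod>x\<in>{x. P x > 0}. v x powr P x) = 0"
    using z by (intro prod_zero) auto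
  ultimately show ?thesis by (simp only:)
next
  case False
  let ?S = "{x. P x > 0}"
  have v_pos: "v x > 0" if "x \<in> ?S" for x
    using False v(1)[of x] that by (cases "v x = 0") auto
  have P_zero: "P x = 0" if "x \<notin> ?S" for x
    using P that by (auto simp: is_distr_def intro: antisym)
  \<comment> \<open>On the support \<open>v\<close> is positive, so \<open>v powr s\<close> is an
    exponential in \<open>s\<close>, differentiable at 0 as well.\<close>
  define \<phi> where "\<phi> s = (\<Sum>x\<in>?S. P x * exp (s * ln (v x)))" for s
  have "(\<Sum>x\<in>?S. P x) = (\<Sum>x\<in>UNIV. P x)"
    using P_zero by (intro sum.mono_neutral_left) auto
  then have P_sum: "(\<Sum>x\<in>?S. P x) = 1"
    using P by (simp add: is_distr_def)
  then have \<phi>0: "\<phi> 0 = 1" by (simp add: \<phi>_def)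
  have "?S \<noteq> {}" using P_sum by force
  then have \<phi>_pos: "\<phi> s > 0" for s
    unfolding \<phi>_def by (intro sum_pos) auto
  have \<phi>_eq: "(\<Sum>x\<in>UNIV. P x * v x powr s) = \<phi> s" for s
  proof -
    have "(\<Sum>x\<in>UNIV. P x * v x powr s) = (\<Sum>x\<in>?S. P x * v x powr s)"
      using P_zero by (intro sum.mono_neutral_right) auto
    also have "\<dots> = \<phi> s"
      unfolding \<phi>_def
    proof (intro sum.cong refl)
      fix x assume "x \<in> ?S"
      then show "P x * v x powr s = P x * exp (s * ln (v x))"
        using v_pos[of x] by (simp add: powr_def)
    qed
    finally show ?thesis .
  qed
  have "(\<phi> has_real_derivative (\<Sum>x\<in>?S. P x * (exp (0 * ln (v x)) * ln (v x)))) (at 0)"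
    unfolding \<phi>_def[abs_def] by (auto intro!: derivative_eq_intros sum.cong)
  then have "((\<lambda>s. ln (\<phi> s)) has_real_derivative (\<Sum>x\<in>?S. P x * ln (v x))) (at 0)"
    by (auto intro!: derivative_eq_intros simp: \<phi>0)
  \<comment> \<open>A difference quotient at 0, since \<open>ln (\<phi> 0) = 0\<close>.\<close>
  then have "((\<lambda>s. ln (\<phi> s) / s) \<longlongrightarrow> (\<Sum>x\<in>?S. P x * ln (v x))) (at 0)"
    by (simp add: DERIV_def \<phi>0)
  moreover have "filterlim (\<lambda>L. 1 / real (L + 1)) (at 0) sequentially"
    using LIMSEQ_Suc[OF lim_1_over_n] by (simp add: filterlim_at)
  ultimately have "(\<lambda>L. ln (\<phi> (1 / real (L + 1))) / (1 / real (L + 1)))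
      \<longlonglongrightarrow> (\<Sum>x\<in>?S. P x * ln (v x))"
    by (rule filterlim_compose)
  then have "(\<lambda>L. exp (ln (\<phi> (1 / real (L + 1))) / (1 / real (L + 1))))
      \<longlonglongrightarrow> exp (\<Sum>x\<in>?S. P x * ln (v x))"
    by (rule tendsto_exp)
  moreover have "exp (ln (\<phi> s) / (1 / real (L + 1))) = \<phi> s ^ (L + 1)" for s L
  proof -
    have "exp (ln (\<phi> s) / (1 / real (L + 1))) = exp (real (L + 1) * ln (\<phi> s))"
      by (simp add: mult.commute)
    also have "\<dots> = \<phi> s ^ (L + 1)" using \<phi>_pos by (simp only: exp_of_nat_mult exp_ln)
    finally show ?thesis .
  qed
  moreover have "exp (\<Sum>x\<in>?S. P x * ln (v x)) = (\<Prod>x\<in>?S. v x powr P x)"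
    unfolding exp_sum[OF finite]
  proof (intro prod.cong refl)
    fix x assume "x \<in> ?S"
    then show "exp (P x * ln (v x)) = v x powr P x"
      using v_pos[of x] by (simp add: powr_def)
  qed
  ultimately show ?thesis by (simp only: \<phi>_eq)
qed

text \<open>The optimal \<open>Q\<close> is the normalised weighted geometric mean of the output distributions.\<close>

lemma umlaut_inner_min_le:
  assumes W: "is_channel W" and P: "is_distr P"
  defines "g \<equiv> \<lambda>y. \<Prod>x\<in>{x. P x > 0}. W x y powr P x"
  assumes pos: "0 < (\<Sum>y\<in>UNIV. g y)"
  shows "(INF Q\<in>{Q. is_distr Q}. KL_div (\<lambda>(x, y). P x * Q y) (\<lambda>(x, y). P x * W x y))
    \<le> ereal (- ln (\<Sum>y\<in>UNIV. g y))"
proof -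
  let ?S = "{x. P x > 0}"
  define B where "B = (\<Sum>y\<in>UNIV. g y)"
  define Q where "Q y = g y / B" for y
  have B: "B > 0" using pos by (simp add: B_def)
  have g: "g y \<ge> 0" for y unfolding g_def by (intro prod_nonneg) auto
  have Q: "is_distr Q"
    using B g by (auto simp: is_distr_def Q_def B_def simp flip: sum_divide_distrib)
  \<comment> \<open>As \<open>0 powr p = 0\<close>, the mean \<open>g y\<close> vanishes as soon as
    one input of positive mass has \<open>W x y = 0\<close>.\<close>
  have ac: "W x y \<noteq> 0" if "P x > 0" "Q y > 0" for x y
  proof
    assume "W x y = 0"
    then have "g y = 0" unfolding g_def using that(1) by (intro prod_zero) auto
    then show False using that(2) by (simp add: Q_def)
  qed
  have P_zero: "P x = 0" if "x \<notin> ?S" for x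
    using P that by (auto simp: is_distr_def intro: antisym)
  have "(\<Sum>x\<in>?S. P x) = (\<Sum>x\<in>UNIV. P x)"
    using P_zero by (intro sum.mono_neutral_left) auto
  then have P_sum: "(\<Sum>x\<in>?S. P x) = 1"
    using P by (simp add: is_distr_def)
  \<comment> \<open>On the support of \<open>Q\<close> the \<open>P\<close>-mean of the log-ratio is
    constant: the geometric mean inside \<open>Q y\<close> cancels that of \<open>W\<close>, and
    only the normalisation remains.\<close>
  have inner: "Q y * (\<Sum>x\<in>UNIV. P x * ln (Q y / W x y)) = Q y * (- ln B)" for y
  proof (cases "Q y = 0")
    case False
    then have "Q y > 0" using Q by (auto simp: is_distr_def less_le)
    then have gy: "g y > 0" using B by (simp add: Q_def zero_less_divide_iff)
    have W_pos: "W x y > 0" if "x \<in> ?S" for x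
      using ac[of x y] that \<open>Q y > 0\<close> is_channel_nonneg[OF W, of x y] by auto
    have "(\<Sum>x\<in>UNIV. P x * ln (Q y / W x y)) = (\<Sum>x\<in>?S. P x * ln (Q y / W x y))"
      using P_zero by (intro sum.mono_neutral_right) auto
    also have "\<dots> = (\<Sum>x\<in>?S. P x * ln (Q y) - P x * ln (W x y))"
    proof (intro sum.cong refl)
      fix x assume "x \<in> ?S"
      then show "P x * ln (Q y / W x y) = P x * ln (Q y) - P x * ln (W x y)"
        using W_pos[of x] \<open>Q y > 0\<close> by (simp add: ln_div right_diff_distrib)
    qed
    also have "\<dots> = ln (Q y) - (\<Sum>x\<in>?S. P x * ln (W x y))"
      using P_sum by (simp add: sum_subtractf flip: sum_distrib_right)
    also have "(\<Sum>x\<in>?S. P x * ln (W x y)) = (\<Sum>x\<in>?S. ln (W x y powr P x))"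
      by (intro sum.cong refl) (simp add: ln_powr)
    also have "\<dots> = ln (g y)"
      unfolding g_def using W_pos by (intro ln_prod[symmetric]) force+
    also have "ln (Q y) - ln (g y) = - ln B"
      using gy B by (simp add: Q_def ln_div)
    finally show ?thesis by simp
  qed simp
  have "(\<Sum>x\<in>UNIV. P x * (\<Sum>y\<in>UNIV. Q y * ln (Q y / W x y)))
      = (\<Sum>y\<in>UNIV. Q y * (\<Sum>x\<in>UNIV. P x * ln (Q y / W x y)))"
    unfolding sum_distrib_left by (subst sum.swap) (simp add: mult_ac)
  also have "\<dots> = - ln B"
    using Q unfolding inner sum_distrib_right[symmetric] by (simp add: is_distr_def)
  finally have "KL_div (\<lambda>(x, y). P x * Q y) (\<lambda>(x, y). P x * W x y) = ereal (- ln B)"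
    using KL_div_product[OF P Q ac] by simp
  then show ?thesis using Q unfolding B_def by (intro INF_lower2[of Q]) auto
qed

section \<open>Exponents\<close>

abbreviation code_size :: "nat \<Rightarrow> real \<Rightarrow> nat \<Rightarrow> nat" where
  "code_size L r n \<equiv> nat \<lceil>real L * exp (r * real n)\<rceil>"

lemma code_size_bounds:
  "real L * exp (r * real n) \<le> code_size L r n"
  "code_size L r n \<le> real L * exp (r * real n) + 1"
proof -
  show "real L * exp (r * real n) \<le> code_size L r n" by (rule real_nat_ceiling_ge)
  have "0 \<le> real L * exp (r * real n)" by simp
  then have "0 \<le> \<lceil>real L * exp (r * real n)\<rceil>" by linarith
  then show "code_size L r n \<le> real L * exp (r * real n) + 1"
    using of_int_ceiling_le_add_one[of "real L * exp (r * real n)"] by (simp only: of_nat_nat)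
qed

text \<open>At a positive rate \<open>L / M\<close> decays exponentially, so the converse bound
  divided by \<open>n\<close> tends to \<open>u\<close>.\<close>

lemma list_exponent_le:
  assumes W: "is_channel W" and u: "umlaut_info W < ereal u" and "1 \<le> L" "0 < r"
  shows "list_exponent L r W \<le> ereal u"
proof -
  let ?M = "code_size L r" and ?c = "\<lambda>n. (u + ln 2 / real n) / (1 - real L / code_size L r n)"
  \<comment> \<open>At \<open>n = 0\<close> the code size is \<open>L\<close> itself and a list
    contains every message.\<close>
  have M: "L < ?M n" if "1 \<le> n" for n
  proof -
    have "real L * 1 < real L * exp (r * real n)"
      using \<open>1 \<le> L\<close> \<open>0 < r\<close> that by (intro mult_strict_left_mono) auto
    then show ?thesis using code_size_bounds(1)[of L r n] by linarith
  qed
  have lim: "(\<lambda>n. exp (- r) ^ n) \<longlonglongrightarrow> 0"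
    using \<open>0 < r\<close> by (intro LIMSEQ_power_zero) auto
  have "(\<lambda>n. real L / ?M n) \<longlonglongrightarrow> 0"
  proof (rule tendsto_sandwich[OF _ _ tendsto_const lim])
    have "real L / ?M n \<le> exp (- r) ^ n" for n
    proof -
      have "real L / ?M n \<le> real L / (real L * exp (r * real n))"
        using code_size_bounds(1)[of L r n] \<open>1 \<le> L\<close> by (intro divide_left_mono mult_pos_pos) (auto intro: less_le_trans)
      also have "\<dots> = exp (- r) ^ n"
        using \<open>1 \<le> L\<close> by (simp add: exp_minus inverse_eq_divide mult.commute power_one_over flip: exp_of_nat_mult)
      finally show ?thesis .
    qed
    then show "\<forall>\<^sub>F n in sequentially. real L / ?M n \<le> exp (- r) ^ n" by simp
  qed (intro always_eventually allI divide_nonneg_nonneg of_nat_0_le_iff)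
  then have "?c \<longlonglongrightarrow> (u + 0) / (1 - 0)"
    by (intro tendsto_intros) (auto intro: lim_const_over_n)
  then have "(\<lambda>n. ereal (?c n)) \<longlonglongrightarrow> ereal u" by simp
  then have lim_c: "liminf (\<lambda>n. ereal (?c n)) = ereal u" by (intro lim_imp_Liminf) auto
  have "\<forall>\<^sub>F n in sequentially. neg_log_rate (eps_n L (?M n) n W) n \<le> ereal (?c n)"
    using eventually_ge_at_top[of 1]
  proof eventually_elim
    case (elim n)
    let ?e = "eps_n L (?M n) n W" and ?d = "1 - real L / ?M n"
    have ge: "exp (- ((n * u + ln 2) / ?d)) \<le> ?e" by (rule eps_n_ge[OF W u M[OF elim]])
    then have "?e > 0" by (rule less_le_trans[OF exp_gt_zero])
    with ge have "- ((n * u + ln 2) / ?d) \<le> ln ?e" by (simp add: ln_ge_iff)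
    then have "- ln ?e / n \<le> (n * u + ln 2) / ?d / n" by (intro divide_right_mono) auto
    also have "\<dots> = ?c n" using elim by (simp add: add_divide_distrib mult.commute)
    finally show ?case using \<open>?e > 0\<close> by (simp add: neg_log_rate_def)
  qed
  then have "list_exponent L r W \<le> liminf (\<lambda>n. ereal (?c n))"
    unfolding list_exponent_def by (rule Liminf_mono)
  then show ?thesis unfolding lim_c .
qed

text \<open>The factor \<open>M ^ L\<close> of the random coding bound costs \<open>r * L\<close> in
  the exponent. The positive bound \<open>G\<close> stands in for a sum that may be zero and could
  not be put under a logarithm.\<close>

lemma list_exponent_ge:
  fixes r :: real
  assumes W: "is_channel W" and P: "is_distr P" and "1 \<le> L" "0 \<le> r" "0 < G"
    and G: "(\<Sum>y\<in>UNIV. (\<Sum>x\<in>UNIV. P x * W x y powr (1 / real (L + 1))) ^ (L + 1)) \<le> G"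
  shows "ereal (- ln G - r * real L) \<le> list_exponent L r W"
proof -
  let ?M = "code_size L r" and ?c = "\<lambda>n. - (L * ln (real L + 1)) / real n - r * real L - ln G"
  have "?c \<longlonglongrightarrow> 0 - r * real L - ln G"
    by (intro tendsto_intros lim_const_over_n)
  also have "0 - r * real L - ln G = - ln G - r * real L" by simp
  finally have "(\<lambda>n. ereal (?c n)) \<longlonglongrightarrow> ereal (- ln G - r * real L)" by simp
  then have lim_c: "liminf (\<lambda>n. ereal (?c n)) = ereal (- ln G - r * real L)" by (intro lim_imp_Liminf) auto
  have "\<forall>\<^sub>F n in sequentially. ereal (?c n) \<le> neg_log_rate (eps_n L (?M n) n W) n"
    using eventually_ge_at_top[of 1]
  proof eventually_elim
    case (elim n)
    let ?e = "eps_n L (?M n) n W"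
    show ?case
    \<comment> \<open>A nonpositive error has rate \<open>\<infinity>\<close> by
      \<open>neg_log_rate\<close>.\<close>
    proof (cases "?e \<le> 0")
      case False
      have "1 \<le> exp (r * real n)" using \<open>0 \<le> r\<close> by simp
      then have "real L * 1 \<le> real L * exp (r * real n)" by (intro mult_left_mono) auto
      then have "L \<le> ?M n" using code_size_bounds(1)[of L r n] by linarith
      \<comment> \<open>The 1 from rounding up is at most \<open>exp (r * real n)\<close>, which
        turns the factor \<open>L\<close> into \<open>L + 1\<close>.\<close>
      have "?M n \<le> real L * exp (r * real n) + exp (r * real n)"
        using code_size_bounds(2)[of L r n] \<open>1 \<le> exp (r * real n)\<close> by linarith
      then have M_le: "?M n \<le> (real L + 1) * exp (r * real n)" by (simp add: algebra_simps)
      have "?e \<le> real (?M n) ^ L *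
          (\<Sum>y\<in>UNIV. (\<Sum>x\<in>UNIV. P x * W x y powr (1 / real (L + 1))) ^ (L + 1)) ^ n"
        by (rule eps_n_le[OF W P \<open>1 \<le> L\<close> \<open>L \<le> ?M n\<close>])
      also have "\<dots> \<le> ((real L + 1) * exp (r * real n)) ^ L * G ^ n"
      proof (rule mult_mono)
        show "real (?M n) ^ L \<le> ((real L + 1) * exp (r * real n)) ^ L"
          using M_le by (intro power_mono of_nat_0_le_iff)
        show "(\<Sum>y\<in>UNIV. (\<Sum>x\<in>UNIV. P x * W x y powr (1 / real (L + 1))) ^ (L + 1)) ^ n \<le> G ^ n"
          using P by (intro power_mono[OF G] sum_nonneg zero_le_power) (auto simp: is_distr_def)
        show "0 \<le> (\<Sum>y\<in>UNIV. (\<Sum>x\<in>UNIV. P x * W x y powr (1 / real (L + 1))) ^ (L + 1)) ^ n"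
          using P by (intro sum_nonneg zero_le_power) (auto simp: is_distr_def)
      qed simp
      finally have "ln ?e \<le> ln (((real L + 1) * exp (r * real n)) ^ L * G ^ n)"
        using False by (intro ln_mono) auto
      also have "\<dots> = L * (ln (real L + 1) + r * n) + n * ln G"
        using \<open>0 < G\<close> by (simp add: ln_mult ln_realpow)
      finally have "- (L * (ln (real L + 1) + r * n) + n * ln G) / n \<le> - ln ?e / n"
        by (intro divide_right_mono) auto
      moreover have "- (L * (ln (real L + 1) + r * n) + n * ln G) / n = ?c n"
        using elim by (simp add: field_simps)
      ultimately show ?thesis using False by (simp add: neg_log_rate_def)
    qed (simp add: neg_log_rate_def)
  qed
  then have "liminf (\<lambda>n. ereal (?c n)) \<le> list_exponent L r W"
    unfolding list_exponent_def by (rule Liminf_mono)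
  then show ?thesis unfolding lim_c .
qed

section \<open>The limit as the rate tends to zero\<close>

lemma neg_log_rate_antimono:
  assumes "e \<le> e'" shows "neg_log_rate e' n \<le> neg_log_rate e n"
  using assms by (auto simp: neg_log_rate_def divide_right_mono)

text \<open>A larger rate means more messages, and the minimal error is monotone in their
  number.\<close>

lemma list_exponent_antimono:
  assumes W: "is_channel W" and "1 \<le> L" "0 \<le> r" "r \<le> s"
  shows "list_exponent L s W \<le> list_exponent L r W"
  unfolding list_exponent_def
proof (intro Liminf_mono always_eventually allI neg_log_rate_antimono)
  fix n
  have "real L * 1 \<le> real L * exp (r * real n)"
    using \<open>0 \<le> r\<close> by (intro mult_left_mono) auto
  then have "L \<le> code_size L r n" using code_size_bounds(1)[of L r n] by linarith
  moreover have "code_size L r n \<le> code_size L s n"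
    using \<open>r \<le> s\<close> by (intro nat_mono ceiling_mono mult_left_mono) (auto intro: mult_right_mono)
  ultimately show "eps_n L (code_size L r n) n W \<le> eps_n L (code_size L s n) n W"
    unfolding eps_n_def using \<open>1 \<le> L\<close> words_nonempty
    by (intro min_list_error_mono) (auto intro: channel_power_nonneg[OF W])
qed

text \<open>\<open>Lim\<close> has a usable value only once convergence is known. The exponent is
  nonincreasing in \<open>r\<close>, so from the right of 0 it converges to its supremum over
  positive rates.\<close>

lemma list_exponent_zero_rate_eq_SUP:
  assumes W: "is_channel W" and "1 \<le> L"
  shows "list_exponent_zero_rate L W = (SUP r\<in>{0<..}. list_exponent L r W)"
  unfolding list_exponent_zero_rate_def
proof (rule tendsto_Lim)
  let ?E = "\<lambda>r. list_exponent L r W"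
  show "(?E \<longlongrightarrow> (SUP r\<in>{0<..}. ?E r)) (at_right 0)"
  proof (rule order_tendstoI)
    fix a assume "a < (SUP r\<in>{0<..}. ?E r)"
    then obtain s where "0 < s" "a < ?E s" by (auto simp: less_SUP_iff)
    have "\<forall>\<^sub>F r in at_right 0. r \<in> {0<..<s}"
      using \<open>0 < s\<close> by (rule eventually_at_right_real)
    then show "\<forall>\<^sub>F r in at_right 0. a < ?E r"
    proof eventually_elim
      case (elim r)
      then have "?E s \<le> ?E r" by (intro list_exponent_antimono[OF assms]) auto
      with \<open>a < ?E s\<close> show ?case by (rule less_le_trans)
    qed
  next
    fix a assume a: "(SUP r\<in>{0<..}. ?E r) < a"
    show "\<forall>\<^sub>F r in at_right 0. ?E r < a"
      using eventually_at_right_less[of 0]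
    proof eventually_elim
      case (elim r)
      then have "?E r \<le> (SUP r\<in>{0<..}. ?E r)" by (intro SUP_upper) auto
      then show ?case using a by (rule le_less_trans)
    qed
  qed
qed simp

section \<open>Zero-rate exponents against the umlaut information\<close>

lemma list_exponent_zero_rate_le:
  assumes W: "is_channel W" and "1 \<le> L"
  shows "list_exponent_zero_rate L W \<le> umlaut_info W"
  unfolding list_exponent_zero_rate_eq_SUP[OF assms]
proof (rule SUP_least, rule ccontr)
  fix r :: real assume r: "r \<in> {0<..}" and "\<not> list_exponent L r W \<le> umlaut_info W"
  then have "umlaut_info W < list_exponent L r W" by simp
  then obtain u where u: "umlaut_info W < ereal u" "ereal u < list_exponent L r W"
    using ereal_dense2 by blast
  then show False using list_exponent_le[OF W u(1) \<open>1 \<le> L\<close>, of r] r by auto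
qed

text \<open>The choices are made in this order: \<open>P\<close> with inner infimum above
  \<open>a\<close>, then \<open>L\<close> large enough for the power mean to be close to the
  geometric mean, then a rate small enough to pay for that \<open>L\<close>.\<close>

lemma list_exponent_zero_rate_approx:
  assumes W: "is_channel W" and a: "ereal a < umlaut_info W"
  shows "\<exists>L\<ge>1. ereal a \<le> list_exponent_zero_rate L W"
proof -
  from a obtain P where P: "is_distr P"
      and a_less: "ereal a < (INF Q\<in>{Q. is_distr Q}. KL_div (\<lambda>(x, y). P x * Q y) (\<lambda>(x, y). P x * W x y))"
    by (auto simp: umlaut_info_def less_SUP_iff)
  define g where "g y = (\<Prod>x\<in>{x. P x > 0}. W x y powr P x)" for y
  define G where "G L = (\<Sum>y\<in>UNIV. (\<Sum>x\<in>UNIV. P x * W x y powr (1 / real (L + 1))) ^ (L + 1))" for L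
  have W_le: "W x y \<le> 1" for x y
    using W is_distr_le_1 by (auto simp: is_channel_def)
  have "(\<Sum>y\<in>UNIV. g y) < exp (- a)"
  proof (cases "(\<Sum>y\<in>UNIV. g y) > 0")
    case True
    then have "ereal a < ereal (- ln (\<Sum>y\<in>UNIV. g y))"
      using less_le_trans[OF a_less umlaut_inner_min_le[OF W P]] by (simp add: g_def)
    then have "exp (ln (\<Sum>y\<in>UNIV. g y)) < exp (- a)" by simp
    then show ?thesis using True by simp
  next
    case False
    then show ?thesis using exp_gt_zero[of "- a"] by linarith
  qed
  moreover have "G \<longlonglongrightarrow> (\<Sum>y\<in>UNIV. g y)"
    unfolding G_def g_def using is_channel_nonneg[OF W] W_le
    by (intro tendsto_sum power_mean_tendsto_geometric_mean[OF P])
  ultimately have "\<forall>\<^sub>F L in sequentially. G L < exp (- a)"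
    by (intro order_tendstoD(2))
  then have "\<forall>\<^sub>F L in sequentially. G L < exp (- a) \<and> 1 \<le> L"
    using eventually_ge_at_top[of 1] by (rule eventually_conj)
  then obtain L where L: "G L < exp (- a)" "1 \<le> L"
    using eventually_happens'[OF sequentially_bot] by auto
  \<comment> \<open>\<open>G L\<close> may be 0; the midpoint is positive and still below
    \<open>exp (- a)\<close>.\<close>
  define H where "H = (G L + exp (- a)) / 2"
  have "0 \<le> G L"
    unfolding G_def using P by (intro sum_nonneg zero_le_power) (auto simp: is_distr_def)
  then have H: "0 < H" "G L \<le> H" "H < exp (- a)"
    using L(1) exp_gt_zero[of "- a"] unfolding H_def by (simp_all add: field_simps add_nonneg_pos)
  then have "ln H < - a" using ln_less_cancel_iff[of H "exp (- a)"] by simp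
  \<comment> \<open>At this rate the loss \<open>r * L\<close> uses up exactly the gap between
    \<open>- ln H\<close> and \<open>a\<close>.\<close>
  define r where "r = (- ln H - a) / L"
  have "0 < r" using \<open>ln H < - a\<close> L(2) by (simp add: r_def)
  have "ereal (- ln H - r * real L) \<le> list_exponent L r W"
    using \<open>0 < r\<close> H(1,2) unfolding G_def by (intro list_exponent_ge[OF W P L(2)]) auto
  moreover have "- ln H - r * real L = a" using L(2) by (simp add: r_def)
  ultimately have "ereal a \<le> list_exponent L r W" by simp
  also have "\<dots> \<le> list_exponent_zero_rate L W"
    unfolding list_exponent_zero_rate_eq_SUP[OF W L(2)] using \<open>0 < r\<close> by (intro SUP_upper) auto
  finally show ?thesis using L(2) by auto
qed

theorem mainTheorem3:
  fixes W :: "'x::finite \<Rightarrow> 'y::finite \<Rightarrow> real"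
  assumes "is_channel W"
  shows "(\<forall>L::nat. L \<ge> 1 \<longrightarrow> list_exponent_zero_rate L W \<le> umlaut_info W)
         \<and> (SUP L\<in>{1::nat..}. list_exponent_zero_rate L W) = umlaut_info W"
proof
  show "\<forall>L::nat. L \<ge> 1 \<longrightarrow> list_exponent_zero_rate L W \<le> umlaut_info W"
    using list_exponent_zero_rate_le[OF assms] by blast
  then have "(SUP L\<in>{1::nat..}. list_exponent_zero_rate L W) \<le> umlaut_info W"
    by (intro SUP_least) auto
  moreover have "umlaut_info W \<le> (SUP L\<in>{1::nat..}. list_exponent_zero_rate L W)"
  proof (rule ccontr)
    assume "\<not> umlaut_info W \<le> (SUP L\<in>{1::nat..}. list_exponent_zero_rate L W)"
    then have "(SUP L\<in>{1::nat..}. list_exponent_zero_rate L W) < umlaut_info W"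
      by (simp only: not_le)
    then obtain a where a: "(SUP L\<in>{1::nat..}. list_exponent_zero_rate L W) < ereal a"
        "ereal a < umlaut_info W"
      using ereal_dense2 by blast
    obtain L where "1 \<le> L" "ereal a \<le> list_exponent_zero_rate L W"
      using list_exponent_zero_rate_approx[OF assms a(2)] by blast
    then have "ereal a \<le> (SUP L\<in>{1::nat..}. list_exponent_zero_rate L W)"
      by (intro SUP_upper2[of L]) auto
    with a(1) show False by simp
  qed
  ultimately show "(SUP L\<in>{1::nat..}. list_exponent_zero_rate L W) = umlaut_info W"
    by (rule antisym)
qed

end
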